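(* Let $0<\epsilon<1$ and let $f\in C^{k}([0,1]\times\mathbb{R})$, $k\geqslant 2$, with $\frac{\partial f}{\partial y}\geqslant m>0$ on $[0,1]\times\mathbb{R}$ ($m$ constant). Let $y$ be the solution of $\epsilon^2y''(x)=f(x,y(x))$ on $[0,1]$, $y(0)=y(1)=0$. Let $N$ be divisible by $4$, $q=1/4$, and assume $\lambda:=\frac{2\epsilon}{\sqrt{m}}\ln N\leqslant q$ and $\epsilon\leqslant C_0/N$ for a constant $C_0$. Let the mesh be $x_i=\varphi(i/N)$, $i=0,\dots,N$, where $$\varphi(t)=\begin{cases}\frac{\lambda}{q}t, & t\in[0,q],\\ p(t-q)^3+\frac{\lambda}{q}t, & t\in[q,1/2],\\ 1-\varphi(1-t), & t\in[1/2,1],\end{cases}\qquad p=\tfrac12\big(1-\tfrac{\lambda}{q}\big)\big(\tfrac12-q\big)^{-3},$$ and $h_i=x_{i+1}-x_i$. Let $\gamma$ be a constant with $\gamma\geqslant\frac{\partial f}{\partial y}$ on $[0,1]\times\mathbb{R}$, $\beta=\sqrt\gamma/\epsilon$, and for $i=1,\dots,N$ let $a_i=1/\sinh(\beta h_{i-1})$, $d_i=1/\tanh(\beta h_{i-1})$, $\Delta d_i=d_i-a_i$. Let $\overline{y}=(\overline{y}_0,\dots,\overline{y}_N)^T$ be the solution of $\overline{y}_0=\overline{y}_N=0$ and, for $i=1,\dots,N-1$, $$\frac{\gamma}{\Delta d_i+\Delta d_{i+1}}\Big[(3a_i+d_i+\Delta d_{i+1})(\overline{y}_{i-1}-\overline{y}_i)-(3a_{i+1}+d_{i+1}+\Delta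 d_i)(\overline{y}_i-\overline{y}_{i+1})$$ $$\qquad -\frac{f(x_{i-1},\overline{y}_{i-1})+2f(x_i,\overline{y}_i)+f(x_{i+1},\overline{y}_{i+1})}{\gamma}(\Delta d_i+\Delta d_{i+1})\Big]=0.$$ Then the scheme is uniformly convergent with respect to $\epsilon$: there is a constant $C>0$ independent of $N$ and $\epsilon$ such that $$|y(x_i)-\overline{y}_i|\leqslant\begin{cases} C\dfrac{\ln^2N}{N^2}, & i=0,\dots,\frac N4-1,\\[2mm] C\dfrac{1}{N^2}, & i=\frac N4,\dots,\frac{3N}{4},\\[2mm] C\dfrac{\ln^2N}{N^2}, & i=\frac{3N}{4}+1,\dots,N.\end{cases}$$
   Context: The mesh is a smoothed (modified) Shishkin mesh with transition point $\lambda$, refined in the boundary layers near $x=0$ and $x=1$. Constants $C$ are independent of $N$ and $\epsilon$. *)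

theory Defs
  imports "HOL-Analysis.Analysis"
begin

fun Ck_on :: "nat \<Rightarrow> (real \<times> real) set \<Rightarrow> (real \<times> real \<Rightarrow> real) \<Rightarrow> bool" where
  "Ck_on 0 S g = continuous_on S g"
| "Ck_on (Suc k) S g =
     (\<exists>gx gy. (\<forall>p\<in>S. (g has_derivative (\<lambda>(u,v). gx p * u + gy p * v)) (at p within S))
              \<and> Ck_on k S gx \<and> Ck_on k S gy)"

definition q_mesh :: real where "q_mesh = 1/4"

definition p_mesh :: "real \<Rightarrow> real" where
  "p_mesh lam = (1/2) * (1 - lam / q_mesh) * (1/2 - q_mesh) powr (-3)"

definition phi0 :: "real \<Rightarrow> real \<Rightarrow> real" where
  "phi0 lam t = (if t \<le> q_mesh then lam / q_mesh * t
                 else p_mesh lam * (t - q_mesh)^3 + lam / q_mesh * t)"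

definition phi_mesh :: "real \<Rightarrow> real \<Rightarrow> real" where
  "phi_mesh lam t = (if t \<le> 1/2 then phi0 lam t else 1 - phi0 lam (1 - t))"

definition lam_mesh :: "real \<Rightarrow> real \<Rightarrow> nat \<Rightarrow> real" where
  "lam_mesh m eps N = 2 * eps / sqrt m * ln (real N)"

definition xm :: "real \<Rightarrow> real \<Rightarrow> nat \<Rightarrow> nat \<Rightarrow> real" where
  "xm m eps N i = phi_mesh (lam_mesh m eps N) (real i / real N)"

definition hm :: "real \<Rightarrow> real \<Rightarrow> nat \<Rightarrow> nat \<Rightarrow> real" where
  "hm m eps N i = xm m eps N (i + 1) - xm m eps N i"

definition am :: "real \<Rightarrow> real \<Rightarrow> real \<Rightarrow> nat \<Rightarrow> nat \<Rightarrow> real" where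
  "am gam m eps N i = 1 / sinh (sqrt gam / eps * hm m eps N (i - 1))"

definition dm :: "real \<Rightarrow> real \<Rightarrow> real \<Rightarrow> nat \<Rightarrow> nat \<Rightarrow> real" where
  "dm gam m eps N i = 1 / tanh (sqrt gam / eps * hm m eps N (i - 1))"

definition Ddm :: "real \<Rightarrow> real \<Rightarrow> real \<Rightarrow> nat \<Rightarrow> nat \<Rightarrow> real" where
  "Ddm gam m eps N i = dm gam m eps N i - am gam m eps N i"

end

theory Submission
  imports Defs
begin

text \<open>
  Since \<open>d_i - a_i = tanh (\<beta> h_{i-1} / 2)\<close>, the scheme says that a three-point operator applied to
  the discrete solution equals \<open>(f_{i-1} + 2 f_i + f_{i+1}) / \<gamma>\<close>, and \<open>f_y \<le> \<gamma>\<close> makes its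
  linearisation an M-matrix, so errors are controlled by barrier functions.

  Let \<open>z\<close> be the solution of the reduced equation \<open>f (x, z x) = 0\<close> and
  \<open>E x = exp (- sqrt m x / \<epsilon>) + exp (- sqrt m (1 - x) / \<epsilon>)\<close>. The maximum principle gives
  \<open>\<bar>y - z\<bar> = O (\<epsilon>\<^sup>2 + E)\<close>, hence \<open>\<epsilon>\<^sup>2 y'' = f (x, y) = O (\<epsilon>\<^sup>2 + E)\<close>, and by differentiating
  the equation twice \<open>\<epsilon>\<^sup>4 y'''' = O (\<epsilon>\<^sup>2 + E)\<close>. Outside the layers \<open>E = O (1 / N\<^sup>2)\<close> by the
  choice of \<open>\<lambda>\<close>, and the local mesh variation is \<open>O (1 / N\<^sup>2)\<close>, which makes the residual
  \<open>O (1 / N\<^sup>2)\<close>; inside the layers the mesh is uniform and fourth-order Taylor expansion gives the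
  residual \<open>O (ln\<^sup>2 N / N\<^sup>2 (\<epsilon>\<^sup>2 + E))\<close>. The error is compared with the barrier
  \<open>K1 / N\<^sup>2 + K2 ln\<^sup>2 N / N\<^sup>2 \<mu> ^ min (i, N - i, N / 4)\<close>, whose last factor dominates \<open>E\<close> and has
  decayed to \<open>O (N powr (- 3 / 2))\<close> at the transition points. That is enough to absorb its kink
  there and to remove the logarithms in the middle of the interval.
\<close>

section \<open>Hyperbolic and exponential estimates\<close>

lemma sinh_real_ge_self:
  fixes x :: real
  assumes "0 \<le> x"
  shows "x \<le> sinh x"
  using real_le_x_sinh[OF assms] by (simp add: sinh_field_def exp_minus)

lemma tanh_real_le_self:
  fixes x :: real
  assumes "0 \<le> x"
  shows "tanh x \<le> x"
proof -
  have "(\<lambda>t. t - tanh t) 0 \<le> (\<lambda>t. t - tanh t) x"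
    by (rule DERIV_nonneg_imp_nondecreasing[OF assms])
       (auto intro!: exI derivative_eq_intros)
  then show ?thesis by simp
qed

lemma tanh_real_ge_diff_square:
  fixes x :: real
  assumes "0 \<le> x"
  shows "x - x\<^sup>2 \<le> tanh x"
proof -
  have tanh_square_le: "(tanh t)\<^sup>2 \<le> 2 * t" if "0 \<le> t" for t :: real
  proof -
    have "tanh t * tanh t \<le> tanh t * 1"
      using that tanh_real_lt_1[of t] by (intro mult_left_mono) auto
    then show ?thesis using tanh_real_le_self[OF that] that by (simp add: power2_eq_square)
  qed
  have "(\<lambda>t. tanh t - (t - t\<^sup>2)) 0 \<le> (\<lambda>t. tanh t - (t - t\<^sup>2)) x"
    by (rule DERIV_nonneg_imp_nondecreasing[OF assms])
       (auto intro!: exI derivative_eq_intros simp: tanh_square_le)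
  then show ?thesis by simp
qed

lemma mult_tanh_real_le:
  fixes c x :: real
  assumes "0 \<le> c" "c \<le> 1" "0 \<le> x"
  shows "c * tanh x \<le> tanh (c * x)"
proof -
  have "(\<lambda>t. tanh (c * t) - c * tanh t) 0 \<le> (\<lambda>t. tanh (c * t) - c * tanh t) x"
  proof (rule DERIV_nonneg_imp_nondecreasing[OF assms(3)], intro exI conjI)
    fix t :: real
    assume "0 \<le> t"
    show "((\<lambda>t. tanh (c * t) - c * tanh t) has_real_derivative
            (1 - (tanh (c * t))\<^sup>2) * c - c * (1 - (tanh t)\<^sup>2)) (at t)"
      by (auto intro!: derivative_eq_intros)
    have "c * t \<le> 1 * t" using assms \<open>0 \<le> t\<close> by (intro mult_right_mono) auto
    then have "(tanh (c * t))\<^sup>2 \<le> (tanh t)\<^sup>2"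
      using assms \<open>0 \<le> t\<close> by (intro power_mono) auto
    then have "0 \<le> c * ((tanh t)\<^sup>2 - (tanh (c * t))\<^sup>2)" using assms by simp
    then show "0 \<le> (1 - (tanh (c * t))\<^sup>2) * c - c * (1 - (tanh t)\<^sup>2)"
      by (simp add: algebra_simps)
  qed
  then show ?thesis by simp
qed

lemma inverse_tanh_square_eq:
  fixes x :: real
  assumes "x \<noteq> 0"
  shows "1 / (tanh x)\<^sup>2 = 1 + 1 / (sinh x)\<^sup>2"
  using assms by (simp add: tanh_def power_divide cosh_square_eq field_simps)

lemma square_div_tanh_square_bounds:
  fixes x :: real
  assumes "0 < x"
  shows "1 \<le> x\<^sup>2 / (tanh x)\<^sup>2" and "x\<^sup>2 / (tanh x)\<^sup>2 \<le> 1 + x\<^sup>2"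
proof -
  have "(tanh x)\<^sup>2 \<le> x\<^sup>2"
    using assms tanh_real_le_self[of x] by (intro power_mono) auto
  then show "1 \<le> x\<^sup>2 / (tanh x)\<^sup>2" using assms by (simp add: pos_le_divide_eq)
  have "x\<^sup>2 \<le> (sinh x)\<^sup>2"
    using assms sinh_real_ge_self[of x] by (intro power_mono) auto
  then have "x\<^sup>2 / (sinh x)\<^sup>2 \<le> 1" by (simp add: divide_le_eq_1)
  moreover have "x\<^sup>2 / (tanh x)\<^sup>2 = x\<^sup>2 + x\<^sup>2 / (sinh x)\<^sup>2"
  proof -
    have "x\<^sup>2 / (tanh x)\<^sup>2 = x\<^sup>2 * (1 / (tanh x)\<^sup>2)" by simp
    also have "1 / (tanh x)\<^sup>2 = 1 + 1 / (sinh x)\<^sup>2"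
      using assms by (intro inverse_tanh_square_eq) simp
    finally show ?thesis by (simp add: distrib_left)
  qed
  ultimately show "x\<^sup>2 / (tanh x)\<^sup>2 \<le> 1 + x\<^sup>2" by simp
qed

lemma cosh_real_minus_1_eq:
  fixes x :: real
  shows "cosh x - 1 = 2 * (sinh (x / 2))\<^sup>2"
  using cosh_double_cosh[of "x / 2"] cosh_square_eq[of "x / 2"] by simp

lemma sinh_mult_tanh_half:
  fixes x :: real
  shows "sinh x * tanh (x / 2) = 2 * (sinh (x / 2))\<^sup>2"
  using sinh_double[of "x / 2"] by (simp add: tanh_def power2_eq_square)

lemma coth_minus_csch_eq_tanh_half:
  fixes x :: real
  assumes "x \<noteq> 0"
  shows "1 / tanh x - 1 / sinh x = tanh (x / 2)"
proof -
  have "sinh x \<noteq> 0" using assms by simp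
  then have "1 / tanh x - 1 / sinh x = (cosh x - 1) / sinh x"
    by (simp add: tanh_def field_simps)
  also have "\<dots> = tanh (x / 2)"
    using sinh_mult_tanh_half[of x] cosh_real_minus_1_eq[of x] \<open>sinh x \<noteq> 0\<close>
    by (simp add: field_simps)
  finally show ?thesis .
qed

lemma abs_deriv_self_div_sinh_le:
  fixes x :: real
  assumes "0 < x"
  shows "\<bar>(sinh x - x * cosh x) / (sinh x)\<^sup>2\<bar> \<le> tanh (x / 2)"
proof -
  have "sinh x \<le> x * cosh x"
    using tanh_real_le_self[of x] assms by (simp add: tanh_def field_simps)
  moreover have "x * cosh x - sinh x \<le> tanh (x / 2) * (sinh x)\<^sup>2"
  proof -
    have "x * cosh x \<le> sinh x * cosh x"
      using sinh_real_ge_self[of x] assms by (intro mult_right_mono) auto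
    moreover have "tanh (x / 2) * (sinh x)\<^sup>2 = (cosh x - 1) * sinh x"
      using sinh_mult_tanh_half[of x] cosh_real_minus_1_eq[of x]
      by (simp add: power2_eq_square mult.commute)
    ultimately show ?thesis by (simp add: algebra_simps)
  qed
  moreover have "0 < sinh x" using assms by simp
  ultimately show ?thesis by (simp add: abs_if field_simps)
qed

lemma self_div_sinh_Lipschitz:
  fixes a b D :: real
  assumes "0 < a" "0 < b" "tanh (a / 2) \<le> D" "tanh (b / 2) \<le> D"
  shows "\<bar>b / sinh b - a / sinh a\<bar> \<le> D * \<bar>b - a\<bar>"
proof -
  have "norm (b / sinh b - a / sinh a) \<le> D * norm (b - a)"
  proof (rule field_differentiable_bound[where S = "closed_segment a b"
        and f' = "\<lambda>x. (sinh x - x * cosh x) / (sinh x)\<^sup>2"])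
    fix x assume "x \<in> closed_segment a b"
    then have "min a b \<le> x" "x \<le> max a b"
      by (auto simp: closed_segment_eq_real_ivl split: if_splits)
    then have "0 < x" "tanh (x / 2) \<le> D"
      using assms by (auto simp: min_def max_def split: if_splits intro: order_trans[rotated])
    then show "norm ((sinh x - x * cosh x) / (sinh x)\<^sup>2) \<le> D"
      using abs_deriv_self_div_sinh_le[of x] by simp
    show "((\<lambda>x. x / sinh x) has_real_derivative (sinh x - x * cosh x) / (sinh x)\<^sup>2)
        (at x within closed_segment a b)"
      using \<open>0 < x\<close> by (auto intro!: derivative_eq_intros simp: power2_eq_square)
  qed auto
  then show ?thesis by simp
qed

lemma exp_minus_double_eq_tanh:
  fixes x :: real
  shows "exp (- 2 * x) = (1 - tanh x) / (1 + tanh x)"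
proof -
  have "1 + exp (- 2 * x) \<noteq> 0" using exp_gt_zero[of "- 2 * x"] by linarith
  then show ?thesis by (simp add: tanh_real_altdef field_simps)
qed

lemma moebius_antimono:
  fixes r s :: real
  assumes "0 \<le> r" "r \<le> s"
  shows "(1 - s) / (1 + s) \<le> (1 - r) / (1 + r)"
  using assms by (simp add: field_simps)

lemma ln_square_le:
  fixes x :: real
  assumes "1 \<le> x"
  shows "(ln x)\<^sup>2 \<le> 4 * x"
proof -
  have "ln x = 2 * ln (sqrt x)" using assms by (simp add: ln_sqrt)
  also have "\<dots> \<le> 2 * sqrt x" using ln_bound[of "sqrt x"] assms by simp
  finally have "(ln x)\<^sup>2 \<le> (2 * sqrt x)\<^sup>2" using assms by (intro power_mono) auto
  then show ?thesis using assms by (simp add: power_mult_distrib)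
qed

section \<open>Taylor bounds and the maximum principle\<close>

definition has_two_derivatives ::
  "(real \<Rightarrow> real) \<Rightarrow> (real \<Rightarrow> real) \<Rightarrow> (real \<Rightarrow> real) \<Rightarrow> real set \<Rightarrow> bool" where
  "has_two_derivatives g g' g'' S \<longleftrightarrow>
     (\<forall>x\<in>S. (g has_real_derivative g' x) (at x within S) \<and>
             (g' has_real_derivative g'' x) (at x within S))"

lemma has_two_derivativesD:
  assumes "has_two_derivatives g g' g'' S" "x \<in> S"
  shows "(g has_real_derivative g' x) (at x within S)"
    and "(g' has_real_derivative g'' x) (at x within S)"
  using assms by (auto simp: has_two_derivatives_def)

lemma has_two_derivatives_subset:
  assumes "has_two_derivatives g g' g'' S" "T \<subseteq> S"
  shows "has_two_derivatives g g' g'' T"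
  using assms unfolding has_two_derivatives_def by (blast intro: DERIV_subset)

lemma has_two_derivatives_diff:
  assumes "has_two_derivatives f f' f'' S" "has_two_derivatives g g' g'' S"
  shows "has_two_derivatives (\<lambda>x. f x - g x) (\<lambda>x. f' x - g' x) (\<lambda>x. f'' x - g'' x) S"
  using assms by (auto simp: has_two_derivatives_def intro: DERIV_diff)

lemma has_two_derivatives_cmult:
  assumes "has_two_derivatives g g' g'' S"
  shows "has_two_derivatives (\<lambda>x. c * g x) (\<lambda>x. c * g' x) (\<lambda>x. c * g'' x) S"
  using assms by (auto simp: has_two_derivatives_def intro: DERIV_cmult)

lemma has_two_derivatives_continuous_on:
  assumes "has_two_derivatives g g' g'' S"
  shows "continuous_on S g" "continuous_on S g'"
  using has_two_derivativesD[OF assms]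
  by (auto simp: continuous_on_eq_continuous_within intro: DERIV_continuous)

lemma second_order_Taylor_bound:
  assumes "convex S" "has_two_derivatives g g' g'' S"
    and "\<And>x. x \<in> S \<Longrightarrow> \<bar>g'' x\<bar> \<le> B" and "w \<in> S" "z \<in> S"
  shows "\<bar>g z - g w - g' w * (z - w)\<bar> \<le> B * (z - w)\<^sup>2"
proof -
  let ?f = "\<lambda>i. [g, g', g''] ! i"
  have "norm (?f 0 z - (\<Sum>i\<le>1. ?f i w * (z - w) ^ i / fact i)) \<le> B * norm (z - w) ^ Suc 1 / fact 1"
    by (rule field_Taylor[OF assms(1)])
       (use assms has_two_derivativesD[OF assms(2)] in \<open>auto simp: le_Suc_eq\<close>)
  then show ?thesis by (simp add: algebra_simps power2_eq_square)
qed

lemma fourth_order_Taylor_bound: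
  assumes "convex S" "has_two_derivatives g g1 g2 S" "has_two_derivatives g2 g3 g4 S"
    and "\<And>x. x \<in> S \<Longrightarrow> \<bar>g4 x\<bar> \<le> B" and "w \<in> S" "z \<in> S"
  shows "\<bar>g z - (g w + g1 w * (z - w) + g2 w * (z - w)\<^sup>2 / 2 + g3 w * (z - w) ^ 3 / 6)\<bar>
         \<le> B * (z - w) ^ 4 / 6"
proof -
  let ?f = "\<lambda>i. [g, g1, g2, g3, g4] ! i"
  have "norm (?f 0 z - (\<Sum>i\<le>3. ?f i w * (z - w) ^ i / fact i)) \<le> B * norm (z - w) ^ Suc 3 / fact 3"
    by (rule field_Taylor[OF assms(1)])
       (use assms has_two_derivativesD[OF assms(2)] has_two_derivativesD[OF assms(3)] in
        \<open>auto simp: le_Suc_eq numeral_3_eq_3\<close>)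
  then show ?thesis by (simp add: numeral_eq_Suc fact_numeral algebra_simps)
qed

lemma abs_derivative_le_of_second_derivative:
  assumes "convex S" "has_two_derivatives g g' g'' S"
    and "\<And>x. x \<in> S \<Longrightarrow> \<bar>g'' x\<bar> \<le> B" and "x \<in> S" "t \<in> S" "\<bar>g x\<bar> \<le> A" "\<bar>g t\<bar> \<le> A"
  shows "\<bar>g' x\<bar> * \<bar>t - x\<bar> \<le> 2 * A + B * (t - x)\<^sup>2"
proof -
  have "\<bar>g t - g x - g' x * (t - x)\<bar> \<le> B * (t - x)\<^sup>2"
    by (rule second_order_Taylor_bound[OF assms(1,2)]) (use assms in auto)
  then show ?thesis using assms(6,7) unfolding abs_mult[symmetric] by linarith
qed

lemma second_difference_bound:
  assumes "convex S" "has_two_derivatives g g' g'' S"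
    and "\<And>x. x \<in> S \<Longrightarrow> \<bar>g'' x\<bar> \<le> B" and "x \<in> S" "x - hl \<in> S" "x + hr \<in> S"
  shows "\<bar>g (x - hl) - 2 * g x + g (x + hr) - (hr - hl) * g' x\<bar> \<le> B * (hl\<^sup>2 + hr\<^sup>2)"
proof -
  have Taylor_at_x: "\<bar>g z - g x - g' x * (z - x)\<bar> \<le> B * (z - x)\<^sup>2" if "z \<in> S" for z
    by (rule second_order_Taylor_bound[OF assms(1,2)]) (use assms that in auto)
  show ?thesis
    using Taylor_at_x[OF assms(5)] Taylor_at_x[OF assms(6)] by (simp add: algebra_simps abs_le_iff)
qed

lemma second_difference_quotient_bound:
  assumes "convex S" "has_two_derivatives g g1 g2 S" "has_two_derivatives g2 g3 g4 S"
    and "\<And>x. x \<in> S \<Longrightarrow> \<bar>g4 x\<bar> \<le> B" and "x \<in> S" "x - h \<in> S" "x + h \<in> S" and "0 < h"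
  shows "\<bar>(g (x - h) - 2 * g x + g (x + h)) / h\<^sup>2 - g2 x\<bar> \<le> B * h\<^sup>2 / 3"
proof -
  have Taylor_at_x: "\<bar>g z - (g x + g1 x * (z - x) + g2 x * (z - x)\<^sup>2 / 2 + g3 x * (z - x) ^ 3 / 6)\<bar>
      \<le> B * (z - x) ^ 4 / 6" if "z \<in> S" for z
    by (rule fourth_order_Taylor_bound[OF assms(1-3)]) (use assms that in auto)
  have "\<bar>g (x + h) - (g x + g1 x * h + g2 x * h\<^sup>2 / 2 + g3 x * h ^ 3 / 6)\<bar> \<le> B * h ^ 4 / 6"
    using Taylor_at_x[OF assms(7)] by simp
  moreover have "\<bar>g (x - h) - (g x - g1 x * h + g2 x * h\<^sup>2 / 2 - g3 x * h ^ 3 / 6)\<bar> \<le> B * h ^ 4 / 6"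
    using Taylor_at_x[OF assms(6)] by simp
  ultimately have "\<bar>g (x - h) - 2 * g x + g (x + h) - g2 x * h\<^sup>2\<bar> \<le> B * h ^ 4 / 3"
    by linarith
  also have "B * h ^ 4 / 3 = B * h\<^sup>2 / 3 * h\<^sup>2" by (simp add: power4_eq_xxxx power2_eq_square)
  finally have "\<bar>(g (x - h) - 2 * g x + g (x + h) - g2 x * h\<^sup>2) / h\<^sup>2\<bar> \<le> B * h\<^sup>2 / 3"
    using \<open>0 < h\<close> by (simp add: abs_divide pos_divide_le_eq)
  then show ?thesis using \<open>0 < h\<close> by (simp add: diff_divide_distrib)
qed

lemma second_derivative_nonpos_at_local_max:
  fixes w w' :: "real \<Rightarrow> real"
  assumes "0 < d"
    and deriv: "\<And>t. \<bar>t - c\<bar> < d \<Longrightarrow> (w has_real_derivative w' t) (at t)"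
    and max: "\<And>t. \<bar>t - c\<bar> < d \<Longrightarrow> w t \<le> w c"
    and deriv2: "(w' has_real_derivative l) (at c)"
  shows "l \<le> 0"
proof (rule ccontr)
  assume "\<not> l \<le> 0"
  have "w' c = 0"
    using deriv[of c] max \<open>0 < d\<close>
    by (intro DERIV_local_max[of w _ c d]) (auto simp: abs_minus_commute)
  then obtain e where increase: "0 < e" "\<And>h. 0 < h \<Longrightarrow> h < e \<Longrightarrow> 0 < w' (c + h)"
    using DERIV_pos_inc_right[OF deriv2] \<open>\<not> l \<le> 0\<close> by auto
  define h where "h = min d e / 2"
  have h_bounds: "0 < h" "h < d" "h < e" using \<open>0 < d\<close> \<open>0 < e\<close> by (auto simp: h_def min_def)
  have "\<exists>z>c. z < c + h \<and> w (c + h) - w c = (c + h - c) * w' z"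
    using h_bounds by (intro MVT2 deriv) auto
  then obtain z where mean_value: "c < z" "z < c + h" "w (c + h) - w c = h * w' z" by auto
  have "0 < h * w' z" using increase(2)[of "z - c"] mean_value h_bounds by simp
  moreover have "w (c + h) \<le> w c" using max[of "c + h"] h_bounds by simp
  ultimately show False using mean_value by simp
qed

lemma two_point_maximum_principle:
  assumes deriv: "has_two_derivatives w w' w'' {a..b}"
    and boundary: "w a \<le> 0" "w b \<le> 0"
    and convex_where_pos: "\<And>x. x \<in> {a<..<b} \<Longrightarrow> 0 < w x \<Longrightarrow> 0 < w'' x"
    and "x \<in> {a..b}"
  shows "w x \<le> 0"
proof (rule ccontr)
  assume "\<not> w x \<le> 0"
  have "compact {a..b}" "{a..b} \<noteq> {}" using \<open>x \<in> {a..b}\<close> by auto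
  then obtain c where c_in: "c \<in> {a..b}" and max: "\<And>t. t \<in> {a..b} \<Longrightarrow> w t \<le> w c"
    using continuous_attains_sup[of "{a..b}" w] has_two_derivatives_continuous_on(1)[OF deriv]
    by blast
  have "0 < w c" using max[OF \<open>x \<in> {a..b}\<close>] \<open>\<not> w x \<le> 0\<close> by linarith
  with c_in boundary have interior: "c \<in> {a<..<b}" by (cases "c = a"; cases "c = b") simp_all
  have "w'' c \<le> 0"
  proof (rule second_derivative_nonpos_at_local_max[of "min (c - a) (b - c)"])
    fix t assume "\<bar>t - c\<bar> < min (c - a) (b - c)"
    then have "t \<in> {a<..<b}" by auto
    then show "(w has_real_derivative w' t) (at t)" "w t \<le> w c"
      using has_two_derivativesD(1)[OF deriv, of t] max[of t] by (auto simp: at_within_Icc_at)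
  next
    show "(w' has_real_derivative w'' c) (at c)"
      using has_two_derivativesD(2)[OF deriv c_in] interior by (simp add: at_within_Icc_at)
  qed (use interior in auto)
  with convex_where_pos[OF interior \<open>0 < w c\<close>] show False by simp
qed

section \<open>The reduced problem\<close>

definition has_partial_derivatives ::
  "(real \<times> real \<Rightarrow> real) \<Rightarrow> (real \<times> real \<Rightarrow> real) \<Rightarrow> (real \<times> real \<Rightarrow> real) \<Rightarrow> (real \<times> real) set \<Rightarrow> bool"
  where
  "has_partial_derivatives g gx gy S \<longleftrightarrow>
     (\<forall>p\<in>S. (g has_derivative (\<lambda>(u, v). gx p * u + gy p * v)) (at p within S))"

lemma has_partial_derivatives_continuous_on:
  assumes "has_partial_derivatives g gx gy S"
  shows "continuous_on S g"
  using assms unfolding has_partial_derivatives_def continuous_on_eq_continuous_within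
  by (blast intro: has_derivative_continuous)

lemma derivative_along_graph:
  assumes "has_partial_derivatives g gx gy (A \<times> UNIV)" "x \<in> A"
    and "(y has_real_derivative y') (at x within A)"
  shows "((\<lambda>t. g (t, y t)) has_real_derivative gx (x, y x) + gy (x, y x) * y') (at x within A)"
proof -
  have "((\<lambda>t. (t, y t)) has_derivative (\<lambda>t. (t, t * y'))) (at x within A)"
    using assms(3) unfolding has_field_derivative_def
    by (auto intro!: derivative_eq_intros simp: mult.commute)
  moreover have "(g has_derivative (\<lambda>(u, v). gx (x, y x) * u + gy (x, y x) * v))
      (at (x, y x) within A \<times> UNIV)"
    using assms(1,2) by (auto simp: has_partial_derivatives_def)
  then have "(g has_derivative (\<lambda>(u, v). gx (x, y x) * u + gy (x, y x) * v))
      (at (x, y x) within (\<lambda>t. (t, y t)) ` A)"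
    by (rule has_derivative_subset) auto
  ultimately have "((\<lambda>t. g (t, y t)) has_derivative
      (\<lambda>t. (\<lambda>(u, v). gx (x, y x) * u + gy (x, y x) * v) (t, t * y'))) (at x within A)"
    by (rule has_derivative_in_compose)
  then show ?thesis
    unfolding has_field_derivative_def by (rule has_derivative_eq_rhs) (auto simp: algebra_simps)
qed

lemma derivative_along_fibre:
  assumes "has_partial_derivatives g gx gy (A \<times> UNIV)" "x \<in> A"
  shows "((\<lambda>t. g (x, t)) has_real_derivative gy (x, v)) (at v)"
proof -
  have "((\<lambda>t. (x, t)) has_derivative (\<lambda>t. (0, t))) (at v)"
    by (auto intro!: derivative_eq_intros)
  moreover have "(g has_derivative (\<lambda>(u, w). gx (x, v) * u + gy (x, v) * w))
      (at (x, v) within A \<times> UNIV)"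
    using assms by (auto simp: has_partial_derivatives_def)
  then have "(g has_derivative (\<lambda>(u, w). gx (x, v) * u + gy (x, v) * w))
      (at (x, v) within range (\<lambda>t. (x, t)))"
    by (rule has_derivative_subset) (use assms(2) in auto)
  ultimately have "((\<lambda>t. g (x, t)) has_derivative
      (\<lambda>t. (\<lambda>(u, w). gx (x, v) * u + gy (x, v) * w) (0, t))) (at v)"
    by (rule has_derivative_in_compose)
  then show ?thesis unfolding has_field_derivative_def by simp
qed

lemma Ck_on_Suc_iff:
  "Ck_on (Suc k) S g \<longleftrightarrow>
     (\<exists>gx gy. has_partial_derivatives g gx gy S \<and> Ck_on k S gx \<and> Ck_on k S gy)"
  by (simp add: has_partial_derivatives_def)

lemma Ck_on_SucD: "Ck_on (Suc k) S g \<Longrightarrow> Ck_on k S g"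
proof (induction k arbitrary: g)
  case 0
  then show ?case using has_partial_derivatives_continuous_on unfolding Ck_on_Suc_iff by auto
next
  case (Suc k)
  then show ?case unfolding Ck_on_Suc_iff[of "Suc k"] Ck_on_Suc_iff[of k] by blast
qed

lemma Ck_on_le: "j \<le> k \<Longrightarrow> Ck_on k S g \<Longrightarrow> Ck_on j S g"
  by (induction rule: inc_induct) (auto dest: Ck_on_SucD simp del: Ck_on.simps)

definition sup_abs :: "'a set \<Rightarrow> ('a \<Rightarrow> real) \<Rightarrow> real" where
  "sup_abs A g = (SUP p\<in>A. \<bar>g p\<bar>)"

lemma abs_le_sup_abs:
  assumes "compact A" "continuous_on A g" "p \<in> A"
  shows "\<bar>g p\<bar> \<le> sup_abs A g"
proof -
  have "bdd_above ((\<lambda>p. \<bar>g p\<bar>) ` A)"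
    using assms(1,2)
    by (intro bounded_imp_bdd_above compact_imp_bounded compact_continuous_image continuous_intros)
  then show ?thesis unfolding sup_abs_def using assms(3) by (intro cSUP_upper)
qed

abbreviation (input) strip :: "(real \<times> real) set" where
  "strip \<equiv> {0..1} \<times> UNIV"

locale reaction_term =
  fixes f fx fy fxx fxy fyx fyy :: "real \<times> real \<Rightarrow> real" and m gam :: real
  assumes f_partials: "has_partial_derivatives f fx fy strip"
    and fx_partials: "has_partial_derivatives fx fxx fxy strip"
    and fy_partials: "has_partial_derivatives fy fyx fyy strip"
    and second_partials_continuous: "continuous_on strip fxx" "continuous_on strip fxy"
      "continuous_on strip fyx" "continuous_on strip fyy"
    and m_pos: "0 < m"
    and fy_bounds: "p \<in> strip \<Longrightarrow> m \<le> fy p" "p \<in> strip \<Longrightarrow> fy p \<le> gam"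
begin

lemma m_le_gam: "m \<le> gam"
  using fy_bounds[of "(0, 0)"] by auto

lemma gam_pos: "0 < gam"
  using m_pos m_le_gam by simp

lemma fy_pos: "x \<in> {0..1} \<Longrightarrow> 0 < fy (x, v)"
  using fy_bounds(1)[of "(x, v)"] m_pos by auto

lemmas partials_continuous =
  has_partial_derivatives_continuous_on[OF f_partials]
  has_partial_derivatives_continuous_on[OF fx_partials]
  has_partial_derivatives_continuous_on[OF fy_partials]
  second_partials_continuous

lemma fibre_mean_value:
  assumes "x \<in> {0..1}"
  obtains \<xi> where "\<bar>\<xi> - w\<bar> \<le> \<bar>v - w\<bar>" "f (x, v) - f (x, w) = fy (x, \<xi>) * (v - w)"
proof -
  have increasing_case: "\<exists>\<xi>. a < \<xi> \<and> \<xi> < b \<and> f (x, b) - f (x, a) = (b - a) * fy (x, \<xi>)"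
    if "a < b" for a b
    by (intro MVT2[OF that] derivative_along_fibre[OF f_partials assms])
  show thesis
  proof (cases v w rule: linorder_cases)
    case less
    then obtain \<xi> where "v < \<xi>" "\<xi> < w" "f (x, w) - f (x, v) = (w - v) * fy (x, \<xi>)"
      using increasing_case by blast
    then show thesis using less by (intro that[of \<xi>]) (auto simp: algebra_simps)
  next
    case greater
    then obtain \<xi> where "w < \<xi>" "\<xi> < v" "f (x, v) - f (x, w) = (v - w) * fy (x, \<xi>)"
      using increasing_case by blast
    then show thesis using greater by (intro that[of \<xi>]) auto
  qed (use that in auto)
qed

lemma fibre_difference_bounds:
  assumes "x \<in> {0..1}"
  shows "m * \<bar>v - w\<bar> \<le> \<bar>f (x, v) - f (x, w)\<bar>"
    and "\<bar>f (x, v) - f (x, w)\<bar> \<le> gam * \<bar>v - w\<bar>"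
proof -
  obtain \<xi> where "f (x, v) - f (x, w) = fy (x, \<xi>) * (v - w)"
    using fibre_mean_value[OF assms] by metis
  then have "\<bar>f (x, v) - f (x, w)\<bar> = fy (x, \<xi>) * \<bar>v - w\<bar>"
    using fy_pos[OF assms, of \<xi>] by (simp add: abs_mult)
  then show "m * \<bar>v - w\<bar> \<le> \<bar>f (x, v) - f (x, w)\<bar>"
    and "\<bar>f (x, v) - f (x, w)\<bar> \<le> gam * \<bar>v - w\<bar>"
    using fy_bounds[of "(x, \<xi>)"] assms by (auto intro!: mult_right_mono)
qed

lemma ex_fibre_root:
  assumes "x \<in> {0..1}"
  shows "\<exists>v. f (x, v) = 0"
proof -
  define R where "R = \<bar>f (x, 0)\<bar> / m"
  have R_props: "0 \<le> R" "m * R = \<bar>f (x, 0)\<bar>" using m_pos by (auto simp: R_def)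
  have slope: "\<bar>f (x, 0)\<bar> \<le> fy (x, \<xi>) * R" for \<xi>
    using fy_bounds(1)[of "(x, \<xi>)"] assms R_props mult_right_mono[of m "fy (x, \<xi>)" R] by auto
  obtain \<xi> where "f (x, R) - f (x, 0) = fy (x, \<xi>) * (R - 0)"
    using fibre_mean_value[OF assms] by metis
  then have "0 \<le> f (x, R)" using slope[of \<xi>] by auto
  moreover obtain \<zeta> where "f (x, - R) - f (x, 0) = fy (x, \<zeta>) * (- R - 0)"
    using fibre_mean_value[OF assms] by metis
  then have "f (x, - R) \<le> 0" using slope[of \<zeta>] by auto
  moreover have "continuous_on {- R..R} (\<lambda>v. f (x, v))"
    by (rule continuous_on_compose2[OF partials_continuous(1)])
       (use assms in \<open>auto intro!: continuous_intros\<close>)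
  ultimately show ?thesis using IVT'[of "\<lambda>v. f (x, v)" "- R" 0 R] R_props by auto
qed

definition reduced :: "real \<Rightarrow> real" where
  "reduced x = (SOME v. f (x, v) = 0)"

lemma f_reduced: "x \<in> {0..1} \<Longrightarrow> f (x, reduced x) = 0"
  unfolding reduced_def by (rule someI_ex) (rule ex_fibre_root)

lemma reduced_tendsto:
  assumes "x \<in> {0..1}"
  shows "(reduced \<longlongrightarrow> reduced x) (at x within {0..1})"
proof -
  let ?bound = "\<lambda>t. \<bar>f (t, reduced x)\<bar> / m"
  have "continuous_on {0..1} (\<lambda>t. f (t, reduced x))"
    by (rule continuous_on_compose2[OF partials_continuous(1)]) (auto intro!: continuous_intros)
  then have "((\<lambda>t. f (t, reduced x)) \<longlongrightarrow> f (x, reduced x)) (at x within {0..1})"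
    using assms by (simp add: continuous_on_def)
  then have "(?bound \<longlongrightarrow> \<bar>0\<bar> / m) (at x within {0..1})"
    using f_reduced[OF assms] m_pos by (intro tendsto_intros) auto
  then have bound_tendsto: "(?bound \<longlongrightarrow> 0) (at x within {0..1})" by simp
  have "\<bar>reduced t - reduced x\<bar> \<le> ?bound t" if "t \<in> {0..1}" for t
    using fibre_difference_bounds(1)[OF that, of "reduced t" "reduced x"] f_reduced[OF that] m_pos
    by (simp add: field_simps)
  then have "\<forall>\<^sub>F t in at x within {0..1}. norm (reduced t - reduced x) \<le> ?bound t"
    by (auto simp: eventually_at_filter)
  then have "((\<lambda>t. reduced t - reduced x) \<longlongrightarrow> 0) (at x within {0..1})"
    using bound_tendsto by (rule Lim_null_comparison)
  then show ?thesis by (simp add: LIM_zero_iff)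
qed

definition reduced' :: "real \<Rightarrow> real" where
  "reduced' x = - fx (x, reduced x) / fy (x, reduced x)"

lemma reduced_has_derivative:
  assumes x_in: "x \<in> {0..1}"
  shows "(reduced has_real_derivative reduced' x) (at x within {0..1})"
proof -
  let ?F = "at x within {0..1}"
  have "\<forall>t\<in>{0..1}. \<exists>\<xi>. \<bar>\<xi> - reduced x\<bar> \<le> \<bar>reduced t - reduced x\<bar> \<and>
      f (t, reduced t) - f (t, reduced x) = fy (t, \<xi>) * (reduced t - reduced x)"
    using fibre_mean_value by metis
  then obtain \<xi> where intermediate:
      "\<And>t. t \<in> {0..1} \<Longrightarrow> \<bar>\<xi> t - reduced x\<bar> \<le> \<bar>reduced t - reduced x\<bar>"
      "\<And>t. t \<in> {0..1} \<Longrightarrow> - f (t, reduced x) = fy (t, \<xi> t) * (reduced t - reduced x)"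
    using f_reduced by (metis diff_0)
  have "((\<lambda>t. \<xi> t - reduced x) \<longlongrightarrow> 0) ?F"
  proof (rule Lim_null_comparison)
    show "\<forall>\<^sub>F t in ?F. norm (\<xi> t - reduced x) \<le> \<bar>reduced t - reduced x\<bar>"
      using intermediate(1) by (auto simp: eventually_at_filter)
    show "((\<lambda>t. \<bar>reduced t - reduced x\<bar>) \<longlongrightarrow> 0) ?F"
      using reduced_tendsto[OF x_in] by (simp add: tendsto_rabs_zero_iff LIM_zero_iff)
  qed
  then have "((\<lambda>t. (t, \<xi> t)) \<longlongrightarrow> (x, reduced x)) ?F"
    by (intro tendsto_intros) (simp add: LIM_zero_iff)
  then have fy_tendsto: "((\<lambda>t. fy (t, \<xi> t)) \<longlongrightarrow> fy (x, reduced x)) ?F"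
    using x_in by (intro continuous_on_tendsto_compose[OF partials_continuous(3)])
      (auto simp: eventually_at_filter)
  have "((\<lambda>t. f (t, reduced x)) has_real_derivative fx (x, reduced x)) ?F"
    using derivative_along_graph[OF f_partials x_in, of "\<lambda>_. reduced x" 0] by simp
  then have "((\<lambda>t. f (t, reduced x) / (t - x)) \<longlongrightarrow> fx (x, reduced x)) ?F"
    using f_reduced[OF x_in] by (simp add: has_field_derivative_iff)
  from tendsto_divide[OF tendsto_minus[OF this] fy_tendsto]
  have quotient_tendsto: "((\<lambda>t. - (f (t, reduced x) / (t - x)) / fy (t, \<xi> t)) \<longlongrightarrow> reduced' x) ?F"
    using fy_pos[OF x_in, of "reduced x"] by (simp add: reduced'_def)
  have "- (f (t, reduced x) / (t - x)) / fy (t, \<xi> t) = (reduced t - reduced x) / (t - x)"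
    if "t \<in> {0..1}" for t
    using intermediate(2)[OF that] fy_pos[OF that, of "\<xi> t"] by (simp add: minus_divide_left)
  then have "\<forall>\<^sub>F t in ?F. - (f (t, reduced x) / (t - x)) / fy (t, \<xi> t)
      = (reduced t - reduced x) / (t - x)"
    by (auto simp: eventually_at_filter)
  then show ?thesis
    unfolding has_field_derivative_iff by (rule Lim_transform_eventually[OF quotient_tendsto])
qed

definition reduced'' :: "real \<Rightarrow> real" where
  "reduced'' x =
     (fx (x, reduced x) * (fyx (x, reduced x) + fyy (x, reduced x) * reduced' x)
       - (fxx (x, reduced x) + fxy (x, reduced x) * reduced' x) * fy (x, reduced x))
     / (fy (x, reduced x))\<^sup>2"

lemma reduced_has_two_derivatives: "has_two_derivatives reduced reduced' reduced'' {0..1}"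
  unfolding has_two_derivatives_def
proof (intro ballI conjI)
  fix x :: real
  assume x_in: "x \<in> {0..1}"
  show reduced_deriv: "(reduced has_real_derivative reduced' x) (at x within {0..1})"
    by (rule reduced_has_derivative[OF x_in])
  have "((\<lambda>x. - fx (x, reduced x) / fy (x, reduced x)) has_real_derivative reduced'' x)
      (at x within {0..1})"
    by (rule DERIV_cong[OF DERIV_divide[OF
          DERIV_minus[OF derivative_along_graph[OF fx_partials x_in reduced_deriv]]
          derivative_along_graph[OF fy_partials x_in reduced_deriv]]])
       (use fy_pos[OF x_in, of "reduced x"] in
         \<open>auto simp: reduced''_def power2_eq_square algebra_simps\<close>)
  then show "(reduced' has_real_derivative reduced'' x) (at x within {0..1})"
    by (simp add: reduced'_def[abs_def])
qed

lemma reduced''_continuous_on: "continuous_on {0..1} reduced''"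
proof -
  note reduced_continuous = has_two_derivatives_continuous_on[OF reduced_has_two_derivatives]
  have along_reduced: "continuous_on {0..1} (\<lambda>x. g (x, reduced x))"
    if "continuous_on strip g" for g :: "real \<times> real \<Rightarrow> real"
    by (rule continuous_on_compose2[OF that]) (auto intro!: continuous_intros reduced_continuous)
  have "fy (x, reduced x) \<noteq> 0" if "x \<in> {0..1}" for x
    using fy_pos[OF that, of "reduced x"] by simp
  then show ?thesis
    unfolding reduced''_def[abs_def]
    by (intro continuous_intros along_reduced partials_continuous reduced_continuous) auto
qed

definition reduced_bound :: real where
  "reduced_bound = sup_abs {0..1} reduced + sup_abs {0..1} reduced' + sup_abs {0..1} reduced''"

lemma reduced_bounds:
  assumes "x \<in> {0..1}"
  shows "\<bar>reduced x\<bar> \<le> reduced_bound" "\<bar>reduced' x\<bar> \<le> reduced_bound" "\<bar>reduced'' x\<bar> \<le> reduced_bound"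
proof -
  have "\<bar>reduced x\<bar> \<le> sup_abs {0..1} reduced" "\<bar>reduced' x\<bar> \<le> sup_abs {0..1} reduced'"
    "\<bar>reduced'' x\<bar> \<le> sup_abs {0..1} reduced''"
    using assms has_two_derivatives_continuous_on[OF reduced_has_two_derivatives]
    by (auto intro!: abs_le_sup_abs reduced''_continuous_on)
  then show "\<bar>reduced x\<bar> \<le> reduced_bound" "\<bar>reduced' x\<bar> \<le> reduced_bound"
    "\<bar>reduced'' x\<bar> \<le> reduced_bound"
    unfolding reduced_bound_def by linarith+
qed

lemma reduced_bound_nonneg: "0 \<le> reduced_bound"
  using reduced_bounds(1)[of 0] by simp

end

section \<open>A priori estimates\<close>

definition layer :: "real \<Rightarrow> real \<Rightarrow> real \<Rightarrow> real" where
  "layer m eps x = exp (- (sqrt m * x / eps)) + exp (- (sqrt m * (1 - x) / eps))"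

definition layer' :: "real \<Rightarrow> real \<Rightarrow> real \<Rightarrow> real" where
  "layer' m eps x =
     sqrt m / eps * (exp (- (sqrt m * (1 - x) / eps)) - exp (- (sqrt m * x / eps)))"

definition envelope :: "real \<Rightarrow> real \<Rightarrow> real \<Rightarrow> real" where
  "envelope m eps x = eps\<^sup>2 + layer m eps x"

lemma layer_pos: "0 < layer m eps x"
  by (simp add: layer_def add_pos_pos)

lemma envelope_pos: "0 < envelope m eps x"
  by (simp add: envelope_def layer_pos add_nonneg_pos)

lemma layer_reflect: "layer m eps (1 - x) = layer m eps x"
  by (simp add: layer_def)

lemma layer_le_2:
  assumes "0 < eps" "0 \<le> m" "x \<in> {0..1}"
  shows "layer m eps x \<le> 2"
proof -
  have "exp (- (sqrt m * x / eps)) \<le> 1" "exp (- (sqrt m * (1 - x) / eps)) \<le> 1"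
    using assms by auto
  then show ?thesis unfolding layer_def by linarith
qed

lemma layer_le_exp_mult_layer:
  assumes "0 < eps" "0 \<le> m" "\<bar>x - z\<bar> \<le> d"
  shows "layer m eps z \<le> exp (sqrt m * d / eps) * layer m eps x"
proof -
  have "sqrt m * (x - z) / eps \<le> sqrt m * d / eps" "sqrt m * (z - x) / eps \<le> sqrt m * d / eps"
    using assms by (auto intro!: divide_right_mono mult_left_mono)
  then have "exp (- (sqrt m * z / eps)) \<le> exp (sqrt m * d / eps + - (sqrt m * x / eps))"
    "exp (- (sqrt m * (1 - z) / eps)) \<le> exp (sqrt m * d / eps + - (sqrt m * (1 - x) / eps))"
    by (simp_all add: diff_divide_distrib right_diff_distrib)
  then show ?thesis unfolding layer_def exp_add distrib_left by linarith
qed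

lemma layer_has_two_derivatives:
  assumes "0 \<le> m" "eps \<noteq> 0"
  shows "has_two_derivatives (layer m eps) (layer' m eps) (\<lambda>x. m / eps\<^sup>2 * layer m eps x) S"
  unfolding has_two_derivatives_def
proof (intro ballI conjI)
  fix x
  show "(layer m eps has_real_derivative layer' m eps x) (at x within S)"
    unfolding layer_def[abs_def] layer'_def using assms(2)
    by (auto intro!: derivative_eq_intros simp: field_simps)
  have "sqrt m / eps * (exp (- (sqrt m * (1 - x) / eps)) * (sqrt m / eps)
        + exp (- (sqrt m * x / eps)) * (sqrt m / eps))
      = sqrt m / eps * (sqrt m / eps) * layer m eps x"
    unfolding layer_def by (simp only: distrib_left distrib_right mult_ac add_ac)
  also have "sqrt m / eps * (sqrt m / eps) = m / eps\<^sup>2"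
    using assms(1) by (simp add: power2_eq_square)
  finally have slope: "sqrt m / eps * (exp (- (sqrt m * (1 - x) / eps)) * (sqrt m / eps)
        + exp (- (sqrt m * x / eps)) * (sqrt m / eps)) = m / eps\<^sup>2 * layer m eps x" .
  have "(layer' m eps has_real_derivative
      sqrt m / eps * (exp (- (sqrt m * (1 - x) / eps)) * (sqrt m / eps)
        + exp (- (sqrt m * x / eps)) * (sqrt m / eps))) (at x within S)"
    unfolding layer'_def[abs_def] using assms(2) by (auto intro!: derivative_eq_intros)
  then show "(layer' m eps has_real_derivative m / eps\<^sup>2 * layer m eps x) (at x within S)"
    unfolding slope .
qed

lemma envelope_has_two_derivatives:
  assumes "0 \<le> m" "eps \<noteq> 0"
  shows "has_two_derivatives (envelope m eps) (layer' m eps) (\<lambda>x. m / eps\<^sup>2 * layer m eps x) S"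
  using layer_has_two_derivatives[OF assms]
  by (auto simp: has_two_derivatives_def envelope_def[abs_def] intro!: derivative_eq_intros)

context reaction_term
begin

definition distance_const :: real where
  "distance_const = reduced_bound + reduced_bound / m"

definition curvature_distance_const :: real where
  "curvature_distance_const = gam * distance_const + reduced_bound"

definition slope_distance_const :: real where
  "slope_distance_const = 4 * distance_const + curvature_distance_const"

definition slope_const :: real where
  "slope_const = reduced_bound + slope_distance_const * exp (sqrt m / 2)"

definition solution_range :: "(real \<times> real) set" where
  "solution_range = {0..1} \<times> cball 0 (reduced_bound + 3 * distance_const)"

definition second_partials_bound :: real where
  "second_partials_bound = sup_abs solution_range fxx + sup_abs solution_range fxy
     + sup_abs solution_range fyx + sup_abs solution_range fyy"

definition curvature_const :: real where
  "curvature_const = 4 * second_partials_bound * (1 + slope_const)\<^sup>2 + gam * (gam * distance_const)"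

definition a_priori_const :: real where
  "a_priori_const = reduced_bound + distance_const + gam * distance_const + slope_const
     + curvature_const"

lemma distance_const_bounds:
  "0 \<le> distance_const" "reduced_bound \<le> distance_const" "reduced_bound \<le> m * distance_const"
  using reduced_bound_nonneg m_pos by (auto simp: distance_const_def distrib_left)

lemma curvature_distance_const_nonneg: "0 \<le> curvature_distance_const"
  using reduced_bound_nonneg distance_const_bounds(1) gam_pos
  by (simp add: curvature_distance_const_def)

lemma slope_distance_const_nonneg: "0 \<le> slope_distance_const"
  using distance_const_bounds(1) curvature_distance_const_nonneg
  by (simp add: slope_distance_const_def)

lemma slope_const_nonneg: "0 \<le> slope_const"
  using reduced_bound_nonneg slope_distance_const_nonneg by (simp add: slope_const_def)

lemma second_partials_bounds:
  assumes "p \<in> solution_range"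
  shows "\<bar>fxx p\<bar> \<le> second_partials_bound" "\<bar>fxy p\<bar> \<le> second_partials_bound"
    "\<bar>fyx p\<bar> \<le> second_partials_bound" "\<bar>fyy p\<bar> \<le> second_partials_bound"
proof -
  have bound: "\<bar>g p\<bar> \<le> sup_abs solution_range g" if "continuous_on strip g" for g
    using assms
    by (intro abs_le_sup_abs continuous_on_subset[OF that])
       (auto simp: solution_range_def compact_Times)
  show "\<bar>fxx p\<bar> \<le> second_partials_bound" "\<bar>fxy p\<bar> \<le> second_partials_bound"
    "\<bar>fyx p\<bar> \<le> second_partials_bound" "\<bar>fyy p\<bar> \<le> second_partials_bound"
    using second_partials_continuous[THEN bound] unfolding second_partials_bound_def by linarith+
qed

lemma second_partials_bound_nonneg: "0 \<le> second_partials_bound"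
proof -
  have "(0, 0) \<in> solution_range"
    using reduced_bound_nonneg distance_const_bounds(1) by (simp add: solution_range_def)
  then show ?thesis using second_partials_bounds(1)[of "(0, 0)"] by simp
qed

lemma a_priori_const_bounds:
  "0 \<le> a_priori_const" "reduced_bound \<le> a_priori_const" "distance_const \<le> a_priori_const"
  "gam * distance_const \<le> a_priori_const" "slope_const \<le> a_priori_const"
  "curvature_const \<le> a_priori_const"
proof -
  have "0 \<le> gam * distance_const" "0 \<le> curvature_const"
    using distance_const_bounds(1) gam_pos second_partials_bound_nonneg
    by (auto simp: curvature_const_def intro!: add_nonneg_nonneg mult_nonneg_nonneg)
  then show "0 \<le> a_priori_const" "reduced_bound \<le> a_priori_const" "distance_const \<le> a_priori_const"
    "gam * distance_const \<le> a_priori_const" "slope_const \<le> a_priori_const"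
    "curvature_const \<le> a_priori_const"
    using reduced_bound_nonneg distance_const_bounds(1) slope_const_nonneg
    unfolding a_priori_const_def by linarith+
qed

end

locale singularly_perturbed_bvp = reaction_term +
  fixes eps :: real and y y' :: "real \<Rightarrow> real"
  assumes eps_pos: "0 < eps" and eps_less_1: "eps < 1"
    and y_solves: "has_two_derivatives y y' (\<lambda>x. f (x, y x) / eps\<^sup>2) {0..1}"
    and y_boundary: "y 0 = 0" "y 1 = 0"
begin

definition y'' :: "real \<Rightarrow> real" where
  "y'' x = f (x, y x) / eps\<^sup>2"

lemma y_has_two_derivatives: "has_two_derivatives y y' y'' {0..1}"
  using y_solves by (simp add: y''_def[abs_def])

lemma ode: "eps\<^sup>2 * y'' x = f (x, y x)"
  using eps_pos by (simp add: y''_def)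

lemma eps_square_le_1: "eps\<^sup>2 \<le> 1"
  using eps_pos eps_less_1 by (simp add: power_le_one)

lemma one_le_envelope_boundary: "1 \<le> envelope m eps 0" "1 \<le> envelope m eps 1"
  by (simp_all add: envelope_def layer_def add_nonneg_nonneg)

lemma distance_convex_above_barrier:
  assumes x_in: "x \<in> {0..1}" and unit_sign: "\<bar>sg\<bar> = 1"
    and above: "distance_const * envelope m eps x < sg * (y x - reduced x)"
  shows "distance_const * (m / eps\<^sup>2 * layer m eps x) < sg * (y'' x - reduced'' x)"
proof -
  have "0 \<le> distance_const * envelope m eps x"
    using distance_const_bounds(1) envelope_pos[of m eps x] by simp
  then have nonneg: "0 \<le> sg * (y x - reduced x)" using above by linarith
  obtain \<xi> where "f (x, y x) = fy (x, \<xi>) * (y x - reduced x)"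
    using fibre_mean_value[OF x_in, of "reduced x" "y x"] f_reduced[OF x_in] by auto
  moreover have "m * (sg * (y x - reduced x)) \<le> fy (x, \<xi>) * (sg * (y x - reduced x))"
    using fy_bounds(1)[of "(x, \<xi>)"] x_in nonneg by (intro mult_right_mono) auto
  ultimately have "m * (sg * (y x - reduced x)) \<le> sg * f (x, y x)"
    by (simp add: mult.left_commute)
  moreover have "m * (distance_const * envelope m eps x) < m * (sg * (y x - reduced x))"
    using above m_pos by simp
  moreover have "eps\<^sup>2 * (sg * reduced'' x) \<le> eps\<^sup>2 * (m * distance_const)"
    using reduced_bounds(3)[OF x_in] unit_sign abs_mult[of sg "reduced'' x"] distance_const_bounds(3)
    by (intro mult_left_mono) auto
  ultimately have scaled:
      "m * distance_const * layer m eps x < sg * f (x, y x) - eps\<^sup>2 * (sg * reduced'' x)"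
    by (simp add: envelope_def algebra_simps)
  have "eps\<^sup>2 * (distance_const * (m / eps\<^sup>2 * layer m eps x)) = m * distance_const * layer m eps x"
    using eps_pos by simp
  also have "\<dots> < sg * f (x, y x) - eps\<^sup>2 * (sg * reduced'' x)" by (fact scaled)
  also have "\<dots> = eps\<^sup>2 * (sg * (y'' x - reduced'' x))"
    by (simp add: right_diff_distrib mult.left_commute flip: ode)
  finally show ?thesis using eps_pos by (simp only: mult_less_cancel_left_pos zero_less_power)
qed

lemma abs_solution_minus_reduced_le:
  assumes x_in: "x \<in> {0..1}"
  shows "\<bar>y x - reduced x\<bar> \<le> distance_const * envelope m eps x"
proof -
  have signed: "sg * (y x - reduced x) - distance_const * envelope m eps x \<le> 0"
    if unit_sign: "\<bar>sg\<bar> = 1" for sg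
  proof (rule two_point_maximum_principle[OF _ _ _ _ x_in])
    have "has_two_derivatives (envelope m eps) (layer' m eps) (\<lambda>x. m / eps\<^sup>2 * layer m eps x) {0..1}"
      using m_pos eps_pos by (intro envelope_has_two_derivatives) auto
    then show "has_two_derivatives
        (\<lambda>x. sg * (y x - reduced x) - distance_const * envelope m eps x)
        (\<lambda>x. sg * (y' x - reduced' x) - distance_const * layer' m eps x)
        (\<lambda>x. sg * (y'' x - reduced'' x) - distance_const * (m / eps\<^sup>2 * layer m eps x)) {0..1}"
      by (intro has_two_derivatives_diff has_two_derivatives_cmult y_has_two_derivatives
          reduced_has_two_derivatives)
  next
    fix t assume "t \<in> {0<..<1}"
      and "0 < sg * (y t - reduced t) - distance_const * envelope m eps t"
    then show "0 < sg * (y'' t - reduced'' t) - distance_const * (m / eps\<^sup>2 * layer m eps t)"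
      using distance_convex_above_barrier[OF _ unit_sign, of t] by auto
  next
    have "distance_const * 1 \<le> distance_const * envelope m eps 0"
      "distance_const * 1 \<le> distance_const * envelope m eps 1"
      by (intro mult_left_mono one_le_envelope_boundary distance_const_bounds(1))+
    moreover have "sg * (y 0 - reduced 0) \<le> reduced_bound" "sg * (y 1 - reduced 1) \<le> reduced_bound"
      using reduced_bounds(1)[of 0] reduced_bounds(1)[of 1] unit_sign y_boundary
      by (auto simp: abs_if split: if_splits)
    ultimately show "sg * (y 0 - reduced 0) - distance_const * envelope m eps 0 \<le> 0"
      "sg * (y 1 - reduced 1) - distance_const * envelope m eps 1 \<le> 0"
      using distance_const_bounds(2) by linarith+
  qed
  show ?thesis using signed[of 1] signed[of "- 1"] by (simp add: abs_le_iff)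
qed

lemma abs_reaction_le:
  assumes "x \<in> {0..1}"
  shows "\<bar>f (x, y x)\<bar> \<le> gam * distance_const * envelope m eps x"
proof -
  have "\<bar>f (x, y x)\<bar> \<le> gam * \<bar>y x - reduced x\<bar>"
    using fibre_difference_bounds(2)[OF assms, of "y x" "reduced x"] f_reduced[OF assms] by simp
  also have "\<dots> \<le> gam * (distance_const * envelope m eps x)"
    using abs_solution_minus_reduced_le[OF assms] gam_pos by (intro mult_left_mono) auto
  finally show ?thesis by (simp add: mult.assoc)
qed

lemma solution_in_range:
  assumes "x \<in> {0..1}"
  shows "(x, y x) \<in> solution_range"
proof -
  have "envelope m eps x \<le> 3"
    using layer_le_2[OF eps_pos _ assms, of m] m_pos eps_square_le_1 by (simp add: envelope_def)
  then have "distance_const * envelope m eps x \<le> distance_const * 3"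
    using distance_const_bounds(1) by (rule mult_left_mono)
  then have "\<bar>y x\<bar> \<le> reduced_bound + 3 * distance_const"
    using abs_solution_minus_reduced_le[OF assms] reduced_bounds(1)[OF assms] by linarith
  then show ?thesis using assms by (simp add: solution_range_def)
qed

lemma abs_curvature_minus_reduced_curvature_le:
  assumes x_in: "x \<in> {0..1}"
  shows "\<bar>y'' x - reduced'' x\<bar> \<le> curvature_distance_const * envelope m eps x / eps\<^sup>2"
proof -
  have "eps\<^sup>2 * \<bar>y'' x\<bar> \<le> gam * distance_const * envelope m eps x"
    using abs_reaction_le[OF x_in] by (simp add: abs_mult flip: ode)
  moreover have "eps\<^sup>2 * \<bar>reduced'' x\<bar> \<le> envelope m eps x * reduced_bound"
    using reduced_bounds(3)[OF x_in] layer_pos[of m eps x]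
    by (intro mult_mono) (auto simp: envelope_def)
  moreover have "eps\<^sup>2 * \<bar>y'' x - reduced'' x\<bar> \<le> eps\<^sup>2 * (\<bar>y'' x\<bar> + \<bar>reduced'' x\<bar>)"
    by (intro mult_left_mono) auto
  ultimately have "eps\<^sup>2 * \<bar>y'' x - reduced'' x\<bar> \<le> curvature_distance_const * envelope m eps x"
    by (simp add: curvature_distance_const_def algebra_simps)
  then show ?thesis using eps_pos by (simp add: field_simps)
qed

lemma abs_slope_minus_reduced_slope_le:
  assumes x_in: "x \<in> {0..1}"
  shows "\<bar>y' x - reduced' x\<bar> * eps
    \<le> slope_distance_const * (eps\<^sup>2 + exp (sqrt m / 2) * layer m eps x)"
proof -
  define H where "H = eps\<^sup>2 + exp (sqrt m / 2) * layer m eps x"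
  let ?G = curvature_distance_const
  have "0 \<le> H" using layer_pos[of m eps x] by (simp add: H_def)
  define t where "t = (if x \<le> 1 / 2 then x + eps / 2 else x - eps / 2)"
  have t_props: "t \<in> {0..1}" "\<bar>t - x\<bar> = eps / 2"
    using x_in eps_pos eps_less_1 by (auto simp: t_def)
  then have segment: "s \<in> {0..1}" "\<bar>x - s\<bar> \<le> eps / 2" if "s \<in> closed_segment x t" for s
    using that x_in by (auto simp: closed_segment_eq_real_ivl split: if_splits)
  have envelope_le: "envelope m eps s \<le> H" if "s \<in> closed_segment x t" for s
    using layer_le_exp_mult_layer[of eps m x s "eps / 2"] eps_pos m_pos segment[OF that]
    by (simp add: envelope_def H_def)
  have "\<bar>y' x - reduced' x\<bar> * \<bar>t - x\<bar> \<le> 2 * (distance_const * H) + ?G * H / eps\<^sup>2 * (t - x)\<^sup>2"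
  proof (rule abs_derivative_le_of_second_derivative)
    have "closed_segment x t \<subseteq> {0..1}" using segment(1) by blast
    then show "has_two_derivatives (\<lambda>x. y x - reduced x) (\<lambda>x. y' x - reduced' x)
        (\<lambda>x. y'' x - reduced'' x) (closed_segment x t)"
      by (intro has_two_derivatives_diff has_two_derivatives_subset[OF y_has_two_derivatives]
          has_two_derivatives_subset[OF reduced_has_two_derivatives])
    have "\<bar>y s - reduced s\<bar> \<le> distance_const * H" if "s \<in> closed_segment x t" for s
      using abs_solution_minus_reduced_le[OF segment(1)[OF that]]
        mult_left_mono[OF envelope_le[OF that] distance_const_bounds(1)] by (rule order_trans)
    then show "\<bar>y x - reduced x\<bar> \<le> distance_const * H" "\<bar>y t - reduced t\<bar> \<le> distance_const * H"
      by auto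
    show "\<bar>y'' s - reduced'' s\<bar> \<le> ?G * H / eps\<^sup>2" if "s \<in> closed_segment x t" for s
      using abs_curvature_minus_reduced_curvature_le[OF segment(1)[OF that]]
      by (rule order_trans) (intro divide_right_mono mult_left_mono envelope_le that
          curvature_distance_const_nonneg zero_le_power2)
  qed auto
  also have "(t - x)\<^sup>2 = eps\<^sup>2 / 4"
    unfolding power2_abs[of "t - x", symmetric] t_props(2) by (simp add: power_divide)
  finally have "\<bar>y' x - reduced' x\<bar> * eps \<le> 4 * (distance_const * H) + ?G * H / 2"
    using eps_pos unfolding t_props(2) by (simp add: field_simps)
  also have "\<dots> \<le> slope_distance_const * H"
    using mult_nonneg_nonneg[OF curvature_distance_const_nonneg \<open>0 \<le> H\<close>]
    unfolding slope_distance_const_def distrib_right by linarith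
  finally show ?thesis unfolding H_def .
qed

lemma abs_slope_le:
  assumes x_in: "x \<in> {0..1}"
  shows "\<bar>y' x\<bar> \<le> slope_const * (1 + layer m eps x / eps)"
proof -
  have "eps\<^sup>2 \<le> exp (sqrt m / 2) * eps"
    unfolding power2_eq_square using eps_pos eps_less_1 m_pos
    by (intro mult_right_mono) (auto intro: order_trans[of _ 1])
  then have "eps\<^sup>2 + exp (sqrt m / 2) * layer m eps x \<le> exp (sqrt m / 2) * (eps + layer m eps x)"
    by (simp add: distrib_left)
  then have "\<bar>y' x - reduced' x\<bar> * eps
      \<le> slope_distance_const * (exp (sqrt m / 2) * (eps + layer m eps x))"
    using abs_slope_minus_reduced_slope_le[OF x_in] mult_left_mono[OF _ slope_distance_const_nonneg]
    by (meson order_trans)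
  then have "\<bar>y' x - reduced' x\<bar>
      \<le> slope_distance_const * exp (sqrt m / 2) * (1 + layer m eps x / eps)"
    using eps_pos by (simp add: field_simps)
  moreover have "\<bar>reduced' x\<bar> * 1 \<le> reduced_bound * (1 + layer m eps x / eps)"
    using reduced_bounds(2)[OF x_in] reduced_bound_nonneg eps_pos layer_pos[of m eps x]
    by (intro mult_mono) auto
  ultimately show ?thesis unfolding slope_const_def by (simp add: distrib_right)
qed

definition y''' :: "real \<Rightarrow> real" where
  "y''' x = (fx (x, y x) + fy (x, y x) * y' x) / eps\<^sup>2"

definition y'''' :: "real \<Rightarrow> real" where
  "y'''' x = (fxx (x, y x) + fxy (x, y x) * y' x
     + ((fyx (x, y x) + fyy (x, y x) * y' x) * y' x + y'' x * fy (x, y x))) / eps\<^sup>2"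

lemma y''_has_two_derivatives: "has_two_derivatives y'' y''' y'''' {0..1}"
  unfolding has_two_derivatives_def
proof (intro ballI conjI)
  fix x :: real
  assume x_in: "x \<in> {0..1}"
  note y_deriv = has_two_derivativesD[OF y_has_two_derivatives x_in]
  show "(y'' has_real_derivative y''' x) (at x within {0..1})"
    unfolding y''_def[abs_def] y'''_def
    by (intro DERIV_cdivide derivative_along_graph[OF f_partials x_in y_deriv(1)])
  show "(y''' has_real_derivative y'''' x) (at x within {0..1})"
    unfolding y'''_def[abs_def] y''''_def
    by (intro DERIV_cdivide DERIV_add DERIV_mult
        derivative_along_graph[OF fx_partials x_in y_deriv(1)]
        derivative_along_graph[OF fy_partials x_in y_deriv(1)] y_deriv(2))
qed

lemma scaled_slope_square_le:
  assumes x_in: "x \<in> {0..1}"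
  shows "(eps * (1 + \<bar>y' x\<bar>))\<^sup>2 \<le> 4 * (1 + slope_const)\<^sup>2 * envelope m eps x"
proof -
  let ?E = "layer m eps x"
  have "0 < ?E" "?E \<le> 2" using layer_pos layer_le_2[OF eps_pos _ x_in, of m] m_pos by auto
  have "1 + \<bar>y' x\<bar> \<le> (1 + slope_const) * (1 + ?E / eps)"
    using abs_slope_le[OF x_in] divide_pos_pos[OF \<open>0 < ?E\<close> eps_pos]
    unfolding distrib_right[of 1 slope_const] mult_1 by linarith
  then have "eps * (1 + \<bar>y' x\<bar>) \<le> eps * ((1 + slope_const) * (1 + ?E / eps))"
    using eps_pos by (intro mult_left_mono) auto
  also have "\<dots> = (1 + slope_const) * (eps + ?E)" using eps_pos by (simp add: field_simps)
  finally have "(eps * (1 + \<bar>y' x\<bar>))\<^sup>2 \<le> (1 + slope_const)\<^sup>2 * (eps + ?E)\<^sup>2"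
    unfolding power_mult_distrib[symmetric] using eps_pos by (intro power_mono) auto
  also have "\<dots> \<le> (1 + slope_const)\<^sup>2 * (4 * envelope m eps x)"
  proof (rule mult_left_mono)
    have "?E\<^sup>2 \<le> 2 * ?E"
      unfolding power2_eq_square using \<open>0 < ?E\<close> \<open>?E \<le> 2\<close> by (intro mult_right_mono) auto
    then show "(eps + ?E)\<^sup>2 \<le> 4 * envelope m eps x"
      using sum_squares_bound[of eps ?E] zero_le_power2[of eps]
      unfolding envelope_def power2_sum distrib_left by linarith
  qed simp
  finally show ?thesis by (simp add: mult_ac)
qed

lemma abs_fourth_derivative_le:
  assumes x_in: "x \<in> {0..1}"
  shows "eps ^ 4 * \<bar>y'''' x\<bar> \<le> curvature_const * envelope m eps x"
proof -
  let ?B = second_partials_bound and ?a = "\<bar>y' x\<bar>" and ?p = "(x, y x)"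
  note partials = second_partials_bounds[OF solution_in_range[OF x_in]]
  have "eps\<^sup>2 * y'''' x = fxx ?p + fxy ?p * y' x + ((fyx ?p + fyy ?p * y' x) * y' x + y'' x * fy ?p)"
    using eps_pos by (simp add: y''''_def)
  moreover have "\<bar>fxy ?p * y' x\<bar> \<le> ?B * ?a" "\<bar>fyx ?p * y' x\<bar> \<le> ?B * ?a"
    "\<bar>fyy ?p * y' x * y' x\<bar> \<le> ?B * ?a * ?a" "\<bar>y'' x * fy ?p\<bar> \<le> \<bar>y'' x\<bar> * gam"
    unfolding abs_mult using partials fy_bounds(2)[of ?p] fy_pos[OF x_in, of "y x"] x_in
    by (auto intro!: mult_right_mono mult_left_mono)
  ultimately have "\<bar>eps\<^sup>2 * y'''' x\<bar> \<le> ?B + ?B * ?a + ?B * ?a + ?B * ?a * ?a + \<bar>y'' x\<bar> * gam"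
    using partials(1) unfolding distrib_right by linarith
  also have "\<dots> = ?B * (1 + ?a)\<^sup>2 + gam * \<bar>y'' x\<bar>"
    by (simp add: power2_sum power2_eq_square algebra_simps)
  finally have "eps\<^sup>2 * \<bar>eps\<^sup>2 * y'''' x\<bar> \<le> eps\<^sup>2 * (?B * (1 + ?a)\<^sup>2 + gam * \<bar>y'' x\<bar>)"
    by (intro mult_left_mono) auto
  also have "\<dots> = ?B * (eps * (1 + ?a))\<^sup>2 + gam * \<bar>f ?p\<bar>"
    unfolding power_mult_distrib ode[symmetric] abs_mult by (simp add: distrib_left mult_ac)
  also have "\<dots> \<le> ?B * (4 * (1 + slope_const)\<^sup>2 * envelope m eps x)
      + gam * (gam * distance_const * envelope m eps x)"
    using scaled_slope_square_le[OF x_in] abs_reaction_le[OF x_in] second_partials_bound_nonneg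
      gam_pos
    by (intro add_mono mult_left_mono) auto
  also have "\<dots> = curvature_const * envelope m eps x"
    by (simp add: curvature_const_def algebra_simps)
  finally show ?thesis by (simp add: abs_mult power4_eq_xxxx power2_eq_square mult.assoc)
qed

lemma a_priori_bounds:
  assumes x_in: "x \<in> {0..1}"
  shows "\<bar>y x - reduced x\<bar> \<le> a_priori_const * envelope m eps x"
    and "\<bar>f (x, y x)\<bar> \<le> a_priori_const * envelope m eps x"
    and "\<bar>y' x\<bar> \<le> a_priori_const + a_priori_const * envelope m eps x / eps"
    and "eps ^ 4 * \<bar>y'''' x\<bar> \<le> a_priori_const * envelope m eps x"
proof -
  have envelope_mono: "c * envelope m eps x \<le> a_priori_const * envelope m eps x"
    if "c \<le> a_priori_const" for c
    using that envelope_pos[of m eps x] by (intro mult_right_mono) auto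
  show "\<bar>y x - reduced x\<bar> \<le> a_priori_const * envelope m eps x"
    "\<bar>f (x, y x)\<bar> \<le> a_priori_const * envelope m eps x"
    "eps ^ 4 * \<bar>y'''' x\<bar> \<le> a_priori_const * envelope m eps x"
    using abs_solution_minus_reduced_le[OF x_in] abs_reaction_le[OF x_in]
      abs_fourth_derivative_le[OF x_in]
      a_priori_const_bounds[THEN envelope_mono] by linarith+
  have "slope_const * (1 + layer m eps x / eps) \<le> a_priori_const * (1 + envelope m eps x / eps)"
    using a_priori_const_bounds(1,5) eps_pos layer_pos[of m eps x]
    by (intro mult_mono add_left_mono divide_right_mono) (auto simp: envelope_def)
  then show "\<bar>y' x\<bar> \<le> a_priori_const + a_priori_const * envelope m eps x / eps"
    using abs_slope_le[OF x_in] by (simp add: distrib_left)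
qed

end

section \<open>The difference scheme\<close>

definition scheme_weight :: "real \<Rightarrow> real \<Rightarrow> real \<Rightarrow> real" where
  "scheme_weight b h h' = 4 / (sinh (b * h) * (tanh (b * h / 2) + tanh (b * h' / 2)))"

definition scheme_op :: "real \<Rightarrow> real \<Rightarrow> real \<Rightarrow> real \<Rightarrow> real \<Rightarrow> real \<Rightarrow> real" where
  "scheme_op b hl hr u v w =
     (scheme_weight b hl hr + 1) * (u - v) + (scheme_weight b hr hl + 1) * (w - v)"

definition weight_drift :: "real \<Rightarrow> real \<Rightarrow> real \<Rightarrow> real" where
  "weight_drift b hl hr = scheme_weight b hr hl * hr - scheme_weight b hl hr * hl"

lemma scheme_weight_pos: "0 < b \<Longrightarrow> 0 < h \<Longrightarrow> 0 < h' \<Longrightarrow> 0 < scheme_weight b h h'"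
  by (simp add: scheme_weight_def add_pos_pos)

lemma scheme_weight_le:
  assumes "0 < b" "0 < h" "0 < h'"
  shows "scheme_weight b h h' \<le> 8 / (b * h)\<^sup>2"
proof -
  have "scheme_weight b h h' \<le> 4 / (sinh (b * h) * tanh (b * h / 2))"
    unfolding scheme_weight_def using assms
    by (intro divide_left_mono mult_left_mono mult_pos_pos add_pos_pos) auto
  also have "\<dots> = 2 / (sinh (b * h / 2))\<^sup>2" unfolding sinh_mult_tanh_half by simp
  also have "\<dots> \<le> 2 / (b * h / 2)\<^sup>2"
    using sinh_real_ge_self[of "b * h / 2"] assms by (intro divide_left_mono power_mono) auto
  finally show ?thesis by (simp add: power_divide)
qed

lemma scheme_op_commute: "scheme_op b hl hr u v w = scheme_op b hr hl w v u"
  by (simp add: scheme_op_def)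

lemma scheme_op_uniform:
  assumes "0 < b" "0 < h"
  shows "scheme_op b h h u v w = (u - 2 * v + w) / (tanh (b * h / 2))\<^sup>2"
proof -
  have "scheme_weight b h h = 2 / (sinh (b * h) * tanh (b * h / 2))"
    by (simp add: scheme_weight_def)
  also have "\<dots> = 1 / (sinh (b * h / 2))\<^sup>2" unfolding sinh_mult_tanh_half by simp
  finally have "scheme_weight b h h + 1 = 1 / (tanh (b * h / 2))\<^sup>2"
    using inverse_tanh_square_eq[of "b * h / 2"] assms by simp
  then have "scheme_op b h h u v w = 1 / (tanh (b * h / 2))\<^sup>2 * (u - 2 * v + w)"
    unfolding scheme_op_def by algebra
  then show ?thesis by simp
qed

lemma abs_weight_drift_eq:
  assumes "0 < b" "0 < hl" "0 < hr"
  shows "\<bar>weight_drift b hl hr\<bar> * (b * (tanh (b * hl / 2) + tanh (b * hr / 2)))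
    = 4 * \<bar>b * hr / sinh (b * hr) - b * hl / sinh (b * hl)\<bar>"
proof -
  define D where "D = tanh (b * hl / 2) + tanh (b * hr / 2)"
  have "0 < D" using assms by (simp add: D_def add_pos_pos)
  have "scheme_weight b hr hl = 4 / (sinh (b * hr) * D)"
    "scheme_weight b hl hr = 4 / (sinh (b * hl) * D)"
    by (simp_all add: scheme_weight_def D_def add.commute)
  then have "scheme_weight b hr hl * hr * (b * D) = 4 * (b * hr / sinh (b * hr))"
    "scheme_weight b hl hr * hl * (b * D) = 4 * (b * hl / sinh (b * hl))"
    using \<open>0 < D\<close> by simp_all
  then have "weight_drift b hl hr * (b * D) = 4 * (b * hr / sinh (b * hr) - b * hl / sinh (b * hl))"
    unfolding weight_drift_def left_diff_distrib right_diff_distrib by simp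
  then have "\<bar>weight_drift b hl hr * (b * D)\<bar>
      = \<bar>4 * (b * hr / sinh (b * hr) - b * hl / sinh (b * hl))\<bar>"
    by (rule arg_cong)
  then show ?thesis using assms \<open>0 < D\<close> unfolding D_def[symmetric] abs_mult by simp
qed

text \<open>The denominator of the weights cancels the Lipschitz constant of \<open>z / sinh z\<close>, so the bound does
  not involve \<open>b\<close>.\<close>

lemma abs_weight_drift_le:
  assumes "0 < b" "0 < hl" "0 < hr"
  shows "\<bar>weight_drift b hl hr\<bar> \<le> 4 * \<bar>hr - hl\<bar>"
proof -
  define D where "D = tanh (b * hl / 2) + tanh (b * hr / 2)"
  have "0 < D" using assms by (simp add: D_def add_pos_pos)
  have "\<bar>b * hr / sinh (b * hr) - b * hl / sinh (b * hl)\<bar> \<le> D * \<bar>b * hr - b * hl\<bar>"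
    by (rule self_div_sinh_Lipschitz) (use assms in \<open>auto simp: D_def\<close>)
  also have "\<dots> = \<bar>hr - hl\<bar> * (b * D)"
    using assms by (simp add: abs_mult flip: right_diff_distrib)
  finally have "\<bar>weight_drift b hl hr\<bar> * (b * D) \<le> 4 * (\<bar>hr - hl\<bar> * (b * D))"
    unfolding abs_weight_drift_eq[OF assms, folded D_def] by simp
  then have "\<bar>weight_drift b hl hr\<bar> * (b * D) \<le> 4 * \<bar>hr - hl\<bar> * (b * D)"
    by (simp only: mult.assoc)
  then show ?thesis using assms \<open>0 < D\<close> by (simp only: mult_le_cancel_right_pos mult_pos_pos)
qed

lemma mult_abs_weight_drift_le:
  assumes "0 < b" "0 < hl" "0 < hr"
  shows "b * \<bar>weight_drift b hl hr\<bar> \<le> 16"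
proof (cases "b * max hl hr \<le> 1")
  case True
  have "b * \<bar>weight_drift b hl hr\<bar> \<le> b * (4 * max hl hr)"
    using abs_weight_drift_le[OF assms] assms by (intro mult_left_mono) (auto simp: max_def)
  then show ?thesis using True by linarith
next
  case False
  have quotient_bounds: "0 \<le> z / sinh z" "z / sinh z \<le> 1" if "0 < z" for z :: real
    using sinh_real_ge_self[of z] that by auto
  have "1 / 4 \<le> tanh (1 / 2 :: real)"
    using tanh_real_ge_diff_square[of "1 / 2"] by (simp add: power2_eq_square)
  also have "\<dots> \<le> tanh (b * max hl hr / 2)" using False by simp
  also have "\<dots> \<le> tanh (b * hl / 2) + tanh (b * hr / 2)" using assms by (auto simp: max_def)
  finally have "b * \<bar>weight_drift b hl hr\<bar> * (1 / 4)
      \<le> b * \<bar>weight_drift b hl hr\<bar> * (tanh (b * hl / 2) + tanh (b * hr / 2))"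
    using assms by (intro mult_left_mono) auto
  also have "\<dots> = 4 * \<bar>b * hr / sinh (b * hr) - b * hl / sinh (b * hl)\<bar>"
    using abs_weight_drift_eq[OF assms] by (simp only: mult_ac)
  also have "\<bar>b * hr / sinh (b * hr) - b * hl / sinh (b * hl)\<bar> \<le> 1"
    using quotient_bounds[OF mult_pos_pos[OF assms(1,2)]]
      quotient_bounds[OF mult_pos_pos[OF assms(1,3)]] by linarith
  finally show ?thesis by simp
qed

lemma scheme_op_second_difference_bound:
  assumes b_pos: "0 < b" and steps: "0 < hl" "0 < hr"
    and stencil_in: "convex S" "x \<in> S" "x - hl \<in> S" "x + hr \<in> S"
    and g_derivs: "has_two_derivatives g g' g'' S" and bound: "\<And>t. t \<in> S \<Longrightarrow> \<bar>g'' t\<bar> \<le> B"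
  shows "\<bar>scheme_op b hl hr (g (x - hl)) (g x) (g (x + hr))
      - (g (x - hl) - 2 * g x + g (x + hr)) - weight_drift b hl hr * g' x\<bar> \<le> 16 * B / b\<^sup>2"
proof -
  define remainder where "remainder t = g t - g x - g' x * (t - x)" for t
  have weighted: "\<bar>scheme_weight b h h' * remainder t\<bar> \<le> 8 * B / b\<^sup>2"
    if "0 < h" "0 < h'" "t \<in> S" "\<bar>t - x\<bar> = h" for h h' t
  proof -
    have "\<bar>remainder t\<bar> \<le> B * (t - x)\<^sup>2"
      unfolding remainder_def
      by (rule second_order_Taylor_bound[OF stencil_in(1) g_derivs])
        (use bound stencil_in that in auto)
    also have "(t - x)\<^sup>2 = h\<^sup>2" using that(4) power2_abs[of "t - x"] by simp
    finally have "\<bar>scheme_weight b h h' * remainder t\<bar> \<le> 8 / (b * h)\<^sup>2 * (B * h\<^sup>2)"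
      unfolding abs_mult
      using scheme_weight_le[OF b_pos that(1,2)] scheme_weight_pos[OF b_pos that(1,2)]
      by (intro mult_mono) auto
    then show ?thesis using that by (simp add: power_mult_distrib)
  qed
  have "scheme_op b hl hr (g (x - hl)) (g x) (g (x + hr))
      - (g (x - hl) - 2 * g x + g (x + hr)) - weight_drift b hl hr * g' x
      = scheme_weight b hl hr * remainder (x - hl) + scheme_weight b hr hl * remainder (x + hr)"
    by (simp add: scheme_op_def weight_drift_def remainder_def algebra_simps)
  then show ?thesis
    using weighted[of hl hr "x - hl"] weighted[of hr hl "x + hr"] steps stencil_in by simp
qed

lemma uniform_scheme_consistency:
  assumes b_pos: "0 < b" and h_pos: "0 < h"
    and stencil_in: "convex S" "x \<in> S" "x - h \<in> S" "x + h \<in> S"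
    and g_derivs: "has_two_derivatives g g1 g2 S" "has_two_derivatives g2 g3 g4 S"
    and bound2: "\<bar>g2 x\<bar> \<le> B2" and bound4: "\<And>t. t \<in> S \<Longrightarrow> \<bar>g4 t\<bar> \<le> B4"
  shows "\<bar>scheme_op b h h (g (x - h)) (g x) (g (x + h)) - (g2 (x - h) + 2 * g2 x + g2 (x + h)) / b\<^sup>2\<bar>
      \<le> h\<^sup>2 * (B2 + (4 + 2 * (b * h / 2)\<^sup>2) * B4 / b\<^sup>2)"
proof -
  define s where "s = b * h / 2"
  define q where "q = s\<^sup>2 / (tanh s)\<^sup>2"
  define r where "r = (g (x - h) - 2 * g x + g (x + h)) / h\<^sup>2 - g2 x"
  define r2 where "r2 = g2 (x - h) - 2 * g2 x + g2 (x + h)"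
  let ?diff = "scheme_op b h h (g (x - h)) (g x) (g (x + h))
    - (g2 (x - h) + 2 * g2 x + g2 (x + h)) / b\<^sup>2"
  have "0 < s" using b_pos h_pos by (simp add: s_def)
  then have q_bounds: "1 \<le> q" "q \<le> 1 + s\<^sup>2" unfolding q_def by (rule square_div_tanh_square_bounds)+
  have "0 \<le> B4" using bound4[OF stencil_in(2)] by linarith
  have "b\<^sup>2 * scheme_op b h h (g (x - h)) (g x) (g (x + h)) = 4 * q * (g2 x + r)"
    unfolding scheme_op_uniform[OF b_pos h_pos] s_def[symmetric]
    using h_pos by (simp add: q_def r_def s_def power_mult_distrib power_divide)
  moreover have "g2 (x - h) + 2 * g2 x + g2 (x + h) = 4 * g2 x + r2" by (simp add: r2_def)
  ultimately have split: "b\<^sup>2 * ?diff = 4 * ((q - 1) * g2 x) + 4 * (q * r) - r2"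
    using b_pos by (simp add: right_diff_distrib) (simp add: algebra_simps)
  have "\<bar>(q - 1) * g2 x\<bar> \<le> s\<^sup>2 * B2"
    unfolding abs_mult using q_bounds bound2 by (intro mult_mono) auto
  moreover have "\<bar>q * r\<bar> \<le> (1 + s\<^sup>2) * (B4 * h\<^sup>2 / 3)"
    unfolding abs_mult
    using q_bounds h_pos
      second_difference_quotient_bound[OF stencil_in(1) g_derivs bound4 stencil_in(2-4)]
    by (intro mult_mono) (auto simp: r_def)
  moreover have "\<bar>r2\<bar> \<le> 2 * (B4 * h\<^sup>2)"
    using second_difference_bound[OF stencil_in(1) g_derivs(2) bound4 stencil_in(2-4)]
    by (simp add: r2_def)
  ultimately have "\<bar>b\<^sup>2 * ?diff\<bar> \<le> 4 * (s\<^sup>2 * B2) + 4 * ((1 + s\<^sup>2) * (B4 * h\<^sup>2 / 3)) + 2 * (B4 * h\<^sup>2)"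
    unfolding split by linarith
  also have "\<dots> = 4 * (s\<^sup>2 * B2) + (10 / 3 + 4 / 3 * s\<^sup>2) * (B4 * h\<^sup>2)"
    by (simp add: field_simps)
  also have "\<dots> \<le> 4 * (s\<^sup>2 * B2) + (4 + 2 * s\<^sup>2) * (B4 * h\<^sup>2)"
    using \<open>0 \<le> B4\<close> by (intro add_left_mono mult_right_mono add_mono) auto
  also have "\<dots> = b\<^sup>2 * (h\<^sup>2 * (B2 + (4 + 2 * s\<^sup>2) * B4 / b\<^sup>2))"
  proof -
    have "4 * (s\<^sup>2 * B2) = b\<^sup>2 * (h\<^sup>2 * B2)" by (simp add: s_def power_mult_distrib power_divide)
    then show ?thesis using b_pos unfolding distrib_left[of "h\<^sup>2" B2] distrib_left[of "b\<^sup>2"] by simp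
  qed
  finally show ?thesis using b_pos unfolding s_def by (simp add: abs_mult)
qed

context singularly_perturbed_bvp
begin

abbreviation beta :: real where
  "beta \<equiv> sqrt gam / eps"

definition truncation_error :: "real \<Rightarrow> real \<Rightarrow> real \<Rightarrow> real" where
  "truncation_error hl hr x = scheme_op beta hl hr (y (x - hl)) (y x) (y (x + hr))
     - (f (x - hl, y (x - hl)) + 2 * f (x, y x) + f (x + hr, y (x + hr))) / gam"

lemma beta_pos: "0 < beta"
  using gam_pos eps_pos by simp

lemma beta_square: "beta\<^sup>2 = gam / eps\<^sup>2"
  using gam_pos by (simp add: power_divide)

lemma second_difference_solution_le:
  assumes steps: "0 < hl" "0 < hr" and stencil: "{x - hl..x + hr} \<subseteq> {0..1}"
    and envelope_le: "\<And>t. t \<in> {x - hl..x + hr} \<Longrightarrow> envelope m eps t \<le> A"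
  shows "\<bar>y (x - hl) - 2 * y x + y (x + hr)\<bar>
    \<le> a_priori_const * (\<bar>hr - hl\<bar> + hl\<^sup>2 + hr\<^sup>2) + 4 * (a_priori_const * A)"
proof -
  let ?S = "{x - hl..x + hr}"
  have points: "x \<in> ?S" "x - hl \<in> ?S" "x + hr \<in> ?S" using steps by auto
  have bounds: "\<bar>reduced' t\<bar> \<le> a_priori_const" "\<bar>reduced'' t\<bar> \<le> a_priori_const" if "t \<in> ?S" for t
    using reduced_bounds[of t] a_priori_const_bounds(2) stencil that by fastforce+
  have "\<bar>reduced (x - hl) - 2 * reduced x + reduced (x + hr) - (hr - hl) * reduced' x\<bar>
      \<le> a_priori_const * (hl\<^sup>2 + hr\<^sup>2)"
    by (rule second_difference_bound
          [OF _ has_two_derivatives_subset[OF reduced_has_two_derivatives stencil]])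
       (use bounds points in auto)
  moreover have "\<bar>(hr - hl) * reduced' x\<bar> \<le> \<bar>hr - hl\<bar> * a_priori_const"
    unfolding abs_mult using bounds(1)[OF points(1)] by (intro mult_left_mono) auto
  moreover have "\<bar>y t - reduced t\<bar> \<le> a_priori_const * A" if "t \<in> ?S" for t
    using a_priori_bounds(1)[of t] stencil that
      mult_left_mono[OF envelope_le[OF that] a_priori_const_bounds(1)]
    by fastforce
  from this[OF points(1)] this[OF points(2)] this[OF points(3)]
  have "\<bar>(y (x - hl) - 2 * y x + y (x + hr)) - (reduced (x - hl) - 2 * reduced x + reduced (x + hr))\<bar>
      \<le> 4 * (a_priori_const * A)" by linarith
  ultimately show ?thesis by (simp add: algebra_simps)
qed

lemma weight_drift_slope_le:
  assumes "0 < hl" "0 < hr" "x \<in> {0..1}" "envelope m eps x \<le> A"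
  shows "\<bar>weight_drift beta hl hr * y' x\<bar>
    \<le> 4 * \<bar>hr - hl\<bar> * a_priori_const + 16 / sqrt gam * (a_priori_const * A)"
proof -
  let ?drift = "\<bar>weight_drift beta hl hr\<bar>" and ?KA = "a_priori_const * A"
  have "0 \<le> ?KA"
    using assms(4) envelope_pos[of m eps x] a_priori_const_bounds(1) by simp
  have "a_priori_const * envelope m eps x / eps \<le> ?KA / eps"
    using assms(4) a_priori_const_bounds(1) eps_pos by (intro divide_right_mono mult_left_mono) auto
  then have "\<bar>weight_drift beta hl hr * y' x\<bar> \<le> ?drift * (a_priori_const + ?KA / eps)"
    unfolding abs_mult using a_priori_bounds(3)[OF assms(3)] by (intro mult_left_mono) auto
  also have "\<dots> = ?drift * a_priori_const + beta * ?drift * (?KA / sqrt gam)"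
    using gam_pos by (simp add: field_simps)
  also have "\<dots> \<le> 4 * \<bar>hr - hl\<bar> * a_priori_const + 16 * (?KA / sqrt gam)"
    using abs_weight_drift_le[OF beta_pos assms(1,2)] mult_abs_weight_drift_le[OF beta_pos assms(1,2)]
      a_priori_const_bounds(1) \<open>0 \<le> ?KA\<close> gam_pos
    by (intro add_mono mult_right_mono) auto
  finally show ?thesis by simp
qed

lemma abs_reaction_le_on:
  assumes "{a..b} \<subseteq> {0..1}" "\<And>t. t \<in> {a..b} \<Longrightarrow> envelope m eps t \<le> A" "t \<in> {a..b}"
  shows "\<bar>f (t, y t)\<bar> \<le> a_priori_const * A" and "\<bar>y'' t\<bar> \<le> a_priori_const * A / eps\<^sup>2"
proof -
  have "t \<in> {0..1}" using assms by blast
  have "\<bar>f (t, y t)\<bar> \<le> a_priori_const * envelope m eps t"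
    by (rule a_priori_bounds(2)[OF \<open>t \<in> {0..1}\<close>])
  also have "\<dots> \<le> a_priori_const * A"
    using assms by (intro mult_left_mono a_priori_const_bounds(1)) auto
  finally show "\<bar>f (t, y t)\<bar> \<le> a_priori_const * A" .
  then show "\<bar>y'' t\<bar> \<le> a_priori_const * A / eps\<^sup>2"
    by (simp add: y''_def divide_right_mono)
qed

lemma abs_truncation_error_le:
  assumes steps: "0 < hl" "0 < hr" and stencil: "{x - hl..x + hr} \<subseteq> {0..1}"
    and envelope_le: "\<And>t. t \<in> {x - hl..x + hr} \<Longrightarrow> envelope m eps t \<le> A"
  shows "\<bar>truncation_error hl hr x\<bar> \<le> a_priori_const * (5 * \<bar>hr - hl\<bar> + hl\<^sup>2 + hr\<^sup>2)
    + (4 + 20 / gam + 16 / sqrt gam) * (a_priori_const * A)"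
proof -
  let ?S = "{x - hl..x + hr}" and ?KA = "a_priori_const * A"
  have points: "x \<in> ?S" "x - hl \<in> ?S" "x + hr \<in> ?S" using steps by auto
  note reaction = abs_reaction_le_on[OF stencil envelope_le]
  have "\<bar>scheme_op beta hl hr (y (x - hl)) (y x) (y (x + hr))
      - (y (x - hl) - 2 * y x + y (x + hr)) - weight_drift beta hl hr * y' x\<bar>
      \<le> 16 * (?KA / eps\<^sup>2) / beta\<^sup>2"
    by (rule scheme_op_second_difference_bound[OF beta_pos steps _ points
          has_two_derivatives_subset[OF y_has_two_derivatives stencil]]) (auto intro: reaction(2))
  also have "16 * (?KA / eps\<^sup>2) / beta\<^sup>2 = 16 / gam * ?KA"
    using eps_pos unfolding beta_square by simp
  finally have remainder: "\<bar>scheme_op beta hl hr (y (x - hl)) (y x) (y (x + hr))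
      - (y (x - hl) - 2 * y x + y (x + hr)) - weight_drift beta hl hr * y' x\<bar> \<le> 16 / gam * ?KA" .
  have "\<bar>f (x - hl, y (x - hl)) + 2 * f (x, y x) + f (x + hr, y (x + hr))\<bar> \<le> 4 * ?KA"
    using reaction(1)[OF _ points(1)] reaction(1)[OF _ points(2)] reaction(1)[OF _ points(3)]
    by linarith
  then have reaction_sum: "\<bar>(f (x - hl, y (x - hl)) + 2 * f (x, y x) + f (x + hr, y (x + hr))) / gam\<bar>
      \<le> 4 / gam * ?KA"
    using gam_pos by (simp add: abs_divide divide_right_mono)
  have "x \<in> {0..1}" using points(1) stencil by blast
  have "\<bar>truncation_error hl hr x\<bar> \<le> \<bar>scheme_op beta hl hr (y (x - hl)) (y x) (y (x + hr))
        - (y (x - hl) - 2 * y x + y (x + hr)) - weight_drift beta hl hr * y' x\<bar>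
      + \<bar>y (x - hl) - 2 * y x + y (x + hr)\<bar> + \<bar>weight_drift beta hl hr * y' x\<bar>
      + \<bar>(f (x - hl, y (x - hl)) + 2 * f (x, y x) + f (x + hr, y (x + hr))) / gam\<bar>"
    unfolding truncation_error_def by linarith
  also have "\<dots> \<le> 16 / gam * ?KA + (a_priori_const * (\<bar>hr - hl\<bar> + hl\<^sup>2 + hr\<^sup>2) + 4 * ?KA)
        + (4 * \<bar>hr - hl\<bar> * a_priori_const + 16 / sqrt gam * ?KA) + 4 / gam * ?KA"
    by (intro add_mono remainder reaction_sum second_difference_solution_le
        weight_drift_slope_le steps stencil envelope_le points(1) \<open>x \<in> {0..1}\<close>)
  also have "\<dots> = a_priori_const * (5 * \<bar>hr - hl\<bar> + hl\<^sup>2 + hr\<^sup>2)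
      + (4 + 20 / gam + 16 / sqrt gam) * ?KA"
    by (simp add: algebra_simps add_divide_distrib)
  finally show ?thesis .
qed

lemma abs_uniform_truncation_error_le:
  assumes h_pos: "0 < h" and stencil: "{x - h..x + h} \<subseteq> {0..1}"
    and envelope_le: "\<And>t. t \<in> {x - h..x + h} \<Longrightarrow> envelope m eps t \<le> A"
  shows "\<bar>truncation_error h h x\<bar>
    \<le> h\<^sup>2 / eps\<^sup>2 * (1 + (4 + 2 * (beta * h / 2)\<^sup>2) / gam) * (a_priori_const * A)"
proof -
  let ?S = "{x - h..x + h}" and ?KA = "a_priori_const * A"
  have points: "x \<in> ?S" "x - h \<in> ?S" "x + h \<in> ?S" using h_pos by auto
  have fourth: "\<bar>y'''' t\<bar> \<le> ?KA / eps ^ 4" if "t \<in> ?S" for t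
  proof -
    have "eps ^ 4 * \<bar>y'''' t\<bar> \<le> ?KA"
      using a_priori_bounds(4)[of t] stencil that
        mult_left_mono[OF envelope_le[OF that] a_priori_const_bounds(1)]
      by fastforce
    then show ?thesis using eps_pos by (simp add: field_simps)
  qed
  have "eps\<^sup>2 * (y'' (x - h) + 2 * y'' x + y'' (x + h))
      = f (x - h, y (x - h)) + 2 * f (x, y x) + f (x + h, y (x + h))"
    by (simp add: distrib_left mult.left_commute flip: ode)
  then have "(y'' (x - h) + 2 * y'' x + y'' (x + h)) / beta\<^sup>2
      = (f (x - h, y (x - h)) + 2 * f (x, y x) + f (x + h, y (x + h))) / gam"
    unfolding beta_square by (simp add: mult.commute)
  then have "\<bar>truncation_error h h x\<bar> \<le>
      h\<^sup>2 * (?KA / eps\<^sup>2 + (4 + 2 * (beta * h / 2)\<^sup>2) * (?KA / eps ^ 4) / beta\<^sup>2)"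
    unfolding truncation_error_def
    using uniform_scheme_consistency[OF beta_pos h_pos _ points
        has_two_derivatives_subset[OF y_has_two_derivatives stencil]
        has_two_derivatives_subset[OF y''_has_two_derivatives stencil]
        abs_reaction_le_on(2)[OF stencil envelope_le points(1)] fourth] by simp
  also have "\<dots> = h\<^sup>2 / eps\<^sup>2 * (1 + (4 + 2 * (beta * h / 2)\<^sup>2) / gam) * ?KA"
    unfolding beta_square using eps_pos gam_pos
    by (simp add: field_simps power4_eq_xxxx power2_eq_square)
  finally show ?thesis .
qed

end

section \<open>Discrete comparison principle\<close>

definition mesh_op :: "real \<Rightarrow> (nat \<Rightarrow> real) \<Rightarrow> (nat \<Rightarrow> real) \<Rightarrow> nat \<Rightarrow> real" where
  "mesh_op b h u i = scheme_op b (h (i - 1)) (h i) (u (i - 1)) (u i) (u (i + 1))"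

definition stencil_sum :: "(nat \<Rightarrow> real) \<Rightarrow> nat \<Rightarrow> real" where
  "stencil_sum u i = u (i - 1) + 2 * u i + u (i + 1)"

definition linearised_op ::
  "real \<Rightarrow> real \<Rightarrow> (nat \<Rightarrow> real) \<Rightarrow> (nat \<Rightarrow> real) \<Rightarrow> (nat \<Rightarrow> real) \<Rightarrow> nat \<Rightarrow> real" where
  "linearised_op b gam h c u i = mesh_op b h u i - stencil_sum (\<lambda>j. c j * u j) i / gam"

lemma mesh_op_diff: "mesh_op b h (\<lambda>j. u j - v j) i = mesh_op b h u i - mesh_op b h v i"
  by (simp add: mesh_op_def scheme_op_def algebra_simps)

lemma stencil_sum_diff: "stencil_sum (\<lambda>j. u j - v j) i = stencil_sum u i - stencil_sum v i"
  by (simp add: stencil_sum_def)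

lemma linearised_op_diff:
  "linearised_op b gam h c (\<lambda>j. u j - v j) i
      = linearised_op b gam h c u i - linearised_op b gam h c v i"
  by (simp add: linearised_op_def mesh_op_diff stencil_sum_diff right_diff_distrib
      diff_divide_distrib)

lemma linearised_op_cmult:
  "linearised_op b gam h c (\<lambda>j. a * u j) i = a * linearised_op b gam h c u i"
  by (simp add: linearised_op_def mesh_op_def scheme_op_def stencil_sum_def
      algebra_simps add_divide_distrib)

lemma linearised_op_antimono_coefficient:
  assumes "0 < gam" "\<And>j. j \<in> {i - 1, i, i + 1} \<Longrightarrow> a j \<le> c j \<and> 0 \<le> u j"
  shows "linearised_op b gam h c u i \<le> linearised_op b gam h a u i"
proof -
  have "a j * u j \<le> c j * u j" if "j \<in> {i - 1, i, i + 1}" for j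
    using assms(2)[OF that] by (intro mult_right_mono) auto
  then have "stencil_sum (\<lambda>j. a j * u j) i \<le> stencil_sum (\<lambda>j. c j * u j) i"
    unfolding stencil_sum_def by (intro add_mono mult_left_mono) auto
  then show ?thesis using assms(1) by (simp add: linearised_op_def divide_right_mono)
qed

lemma discrete_maximum_principle:
  fixes u c h :: "nat \<Rightarrow> real"
  assumes b_pos: "0 < b" and h_pos: "\<And>i. i < N \<Longrightarrow> 0 < h i"
    and c_bounds: "\<And>i. i \<le> N \<Longrightarrow> 0 < c i \<and> c i \<le> gam"
    and boundary: "u 0 \<le> 0" "u N \<le> 0"
    and subsolution: "\<And>i. 0 < i \<Longrightarrow> i < N \<Longrightarrow> 0 \<le> linearised_op b gam h c u i"
    and "i \<le> N"
  shows "u i \<le> 0"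
proof (rule ccontr)
  assume "\<not> u i \<le> 0"
  have "Max (u ` {..N}) \<in> u ` {..N}" by (intro Max_in) auto
  then obtain j where "Max (u ` {..N}) = u j" and j_bounds: "j \<in> {..N}" by (rule imageE)
  then have max: "u i \<le> u j" if "i \<le> N" for i
    using that Max_ge[of "u ` {..N}" "u i"] by simp
  have "0 < u j" using max[OF \<open>i \<le> N\<close>] \<open>\<not> u i \<le> 0\<close> by simp
  with boundary j_bounds have interior: "0 < j" "j < N"
    by (auto intro!: Nat.gr0I le_neq_implies_less)
  have "0 < gam" using c_bounds[of 0] by simp
  define al ar where "al = scheme_weight b (h (j - 1)) (h j)"
    and "ar = scheme_weight b (h j) (h (j - 1))"
  have weights: "0 < al" "0 < ar"
    using h_pos[of j] h_pos[of "j - 1"] interior b_pos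
    by (auto simp: al_def ar_def intro!: scheme_weight_pos)
  have coefficients: "c (j - 1) \<le> gam" "0 < c (j - 1)" "0 < c j" "c (j + 1) \<le> gam" "0 < c (j + 1)"
    using c_bounds[of "j - 1"] c_bounds[of j] c_bounds[of "j + 1"] interior by auto
  have "u (j - 1) \<le> u j" "u (j + 1) \<le> u j" using max[of "j - 1"] max[of "j + 1"] interior by auto
  then have "(al + (1 - c (j - 1) / gam)) * (u (j - 1) - u j) \<le> 0"
    "(ar + (1 - c (j + 1) / gam)) * (u (j + 1) - u j) \<le> 0"
    using weights coefficients \<open>0 < gam\<close>
    by (auto intro!: mult_nonneg_nonpos add_nonneg_nonneg simp: divide_le_eq_1)
  moreover have "0 < (c (j - 1) + 2 * c j + c (j + 1)) / gam * u j"
    using coefficients \<open>0 < gam\<close> \<open>0 < u j\<close> by (intro mult_pos_pos divide_pos_pos) auto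
  moreover have "linearised_op b gam h c u j
      = (al + (1 - c (j - 1) / gam)) * (u (j - 1) - u j)
        + (ar + (1 - c (j + 1) / gam)) * (u (j + 1) - u j)
        - (c (j - 1) + 2 * c j + c (j + 1)) / gam * u j"
    using \<open>0 < gam\<close>
    by (simp add: linearised_op_def mesh_op_def stencil_sum_def scheme_op_def al_def ar_def
        field_simps)
  ultimately show False using subsolution[OF interior] by linarith
qed

lemma discrete_comparison_principle:
  fixes e w c h :: "nat \<Rightarrow> real"
  assumes b_pos: "0 < b" and "0 < m" and h_pos: "\<And>i. i < N \<Longrightarrow> 0 < h i"
    and c_bounds: "\<And>i. i \<le> N \<Longrightarrow> m \<le> c i \<and> c i \<le> gam"
    and w_nonneg: "\<And>i. i \<le> N \<Longrightarrow> 0 \<le> w i"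
    and boundary: "e 0 = 0" "e N = 0"
    and barrier: "\<And>i. 0 < i \<Longrightarrow> i < N \<Longrightarrow>
      linearised_op b gam h (\<lambda>_. m) w i \<le> - \<bar>linearised_op b gam h c e i\<bar>"
    and "i \<le> N"
  shows "\<bar>e i\<bar> \<le> w i"
proof -
  have "0 < gam" using c_bounds[of 0] \<open>0 < m\<close> by simp
  have signed: "sg * e i - w i \<le> 0" if "\<bar>sg\<bar> = 1" for sg
  proof (rule discrete_maximum_principle[OF b_pos h_pos _ _ _ _ \<open>i \<le> N\<close>])
    show "0 < c i \<and> c i \<le> gam" if "i \<le> N" for i using c_bounds[OF that] \<open>0 < m\<close> by simp
    show "sg * e 0 - w 0 \<le> 0" "sg * e N - w N \<le> 0" using boundary w_nonneg by auto
  next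
    fix i
    assume i_inner: "0 < i" "i < N"
    have "linearised_op b gam h c w i \<le> linearised_op b gam h (\<lambda>_. m) w i"
      using i_inner c_bounds w_nonneg
      by (intro linearised_op_antimono_coefficient[OF \<open>0 < gam\<close>]) auto
    also have "\<dots> \<le> - \<bar>linearised_op b gam h c e i\<bar>" by (rule barrier[OF i_inner])
    also have "\<dots> = - \<bar>sg * linearised_op b gam h c e i\<bar>" using that by (simp add: abs_mult)
    finally show "0 \<le> linearised_op b gam h c (\<lambda>j. sg * e j - w j) i"
      unfolding linearised_op_diff linearised_op_cmult by linarith
  qed
  show ?thesis using signed[of 1] signed[of "- 1"] by (simp add: abs_le_iff)
qed

section \<open>The smoothed Shishkin mesh\<close>

locale shishkin_mesh =
  fixes m eps :: real and N :: nat
  assumes m_pos: "0 < m" and eps_pos: "0 < eps"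
    and N_pos: "0 < N" and N_dvd: "4 dvd N" and lam_le: "lam_mesh m eps N \<le> q_mesh"
begin

definition n :: nat where "n = N div 4"

definition lam :: real where "lam = lam_mesh m eps N"

definition fine_step :: real where "fine_step = lam / real n"

definition layer_rate :: real where "layer_rate = (ln (real N))\<^sup>2 / (real N)\<^sup>2"

definition p :: real where "p = p_mesh lam"

abbreviation x :: "nat \<Rightarrow> real" where "x i \<equiv> xm m eps N i"

abbreviation h :: "nat \<Rightarrow> real" where "h i \<equiv> hm m eps N i"

lemma N_eq: "N = 4 * n"
  using N_dvd by (simp add: n_def)

lemma real_N_eq: "real N = 4 * real n"
  using N_eq by simp

lemma n_pos: "0 < n"
  using N_pos N_eq by auto

lemma N_ge_4: "4 \<le> real N"
  using n_pos N_eq by simp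

lemma ln_N_gt_1: "1 < ln (real N)"
proof -
  have "exp 1 < real N" using exp_le N_ge_4 by linarith
  then show ?thesis using N_ge_4 ln_less_cancel_iff[of "exp 1" "real N"] by simp
qed

lemma lam_eq: "lam = 2 * eps / sqrt m * ln (real N)"
  by (simp add: lam_def lam_mesh_def)

lemma lam_bounds: "0 < lam" "lam \<le> 1 / 4"
  using lam_le ln_N_gt_1 eps_pos m_pos by (auto simp: lam_eq q_mesh_def lam_def[symmetric])

lemma fine_step_pos: "0 < fine_step"
  using lam_bounds n_pos by (simp add: fine_step_def)

lemma fine_step_eq: "fine_step = 8 * eps * ln (real N) / (sqrt m * real N)"
  by (simp add: fine_step_def lam_eq real_N_eq)

lemma fine_step_le: "fine_step \<le> 1 / real N"
  using lam_bounds n_pos by (simp add: fine_step_def real_N_eq field_simps)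

lemma scaled_fine_step_le: "sqrt m * fine_step / eps \<le> 8"
proof -
  have "sqrt m * fine_step / eps = 8 * (ln (real N) / real N)"
    using m_pos eps_pos by (simp add: fine_step_eq)
  moreover have "ln (real N) / real N \<le> 1" using ln_bound N_pos by (simp add: divide_le_eq_1)
  ultimately show ?thesis by linarith
qed

lemma scaled_fine_step_square: "fine_step\<^sup>2 / eps\<^sup>2 = 64 / m * layer_rate"
  using m_pos eps_pos by (simp add: fine_step_eq layer_rate_def power_divide power_mult_distrib)

lemma layer_rate_bounds: "0 \<le> layer_rate" "layer_rate \<le> 1"
  using ln_bound[of "real N"] ln_N_gt_1 N_pos
  by (auto simp: layer_rate_def divide_le_eq_1 power_mono)

lemma p_eq: "p = 32 * (1 - 4 * lam)"
proof -
  have "(1 / 4 :: real) powr (- 3) = 64"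
    by (simp add: powr_minus powr_numeral power_divide)
  then show ?thesis by (simp add: p_def p_mesh_def q_mesh_def)
qed

lemma p_bounds: "0 \<le> p" "p \<le> 32"
  using lam_bounds by (auto simp: p_eq)

lemma x_left:
  assumes "i \<le> n"
  shows "x i = real i * fine_step"
proof -
  have "real i / real N \<le> 1 / 4" using assms n_pos by (simp add: real_N_eq)
  then show ?thesis
    by (simp add: xm_def phi_mesh_def phi0_def q_mesh_def lam_def[symmetric] fine_step_def real_N_eq)
qed

lemma x_middle:
  assumes "n \<le> i" "i \<le> 2 * n"
  shows "x i = real i * fine_step + p * ((real i - real n) / real N) ^ 3"
proof (cases "i = n")
  case True
  then show ?thesis using x_left by simp
next
  case False
  then have "1 / 4 < real i / real N" "real i / real N \<le> 1 / 2"
    using assms n_pos by (auto simp: real_N_eq field_simps)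
  moreover have "real i / real N - 1 / 4 = (real i - real n) / real N"
    using n_pos by (simp add: real_N_eq field_simps)
  ultimately show ?thesis
    by (simp add: xm_def phi_mesh_def phi0_def q_mesh_def lam_def[symmetric] p_def[symmetric]
        fine_step_def real_N_eq)
qed

lemma x_half: "x (2 * n) = 1 / 2"
proof -
  have "(real n / real N) ^ 3 = 1 / 64" using n_pos by (simp add: real_N_eq power_divide)
  then show ?thesis using x_middle[of "2 * n"] n_pos by (simp add: p_eq fine_step_def field_simps)
qed

lemma x_reflect:
  assumes "i \<le> N"
  shows "x (N - i) = 1 - x i"
proof -
  have left_half: "x (N - j) = 1 - x j" if "j < 2 * n" for j
  proof -
    have "real (N - j) / real N = 1 - real j / real N"
      using that n_pos N_eq by (simp add: field_simps)
    moreover have "real j / real N < 1 / 2" using that n_pos by (simp add: real_N_eq field_simps)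
    moreover from this have "\<not> 1 - real j / real N \<le> 1 / 2" by linarith
    ultimately show ?thesis
      unfolding xm_def phi_mesh_def by (simp only: if_False if_True less_imp_le) simp
  qed
  consider (left) "i < 2 * n" | (centre) "i = 2 * n" | (right) "2 * n < i" by linarith
  then show ?thesis
  proof cases
    case centre
    then have "N - i = 2 * n" using N_eq by simp
    then show ?thesis using centre x_half by simp
  next
    case right
    then show ?thesis using left_half[of "N - i"] assms N_eq by simp
  qed (use left_half in auto)
qed

lemma h_left: "i < n \<Longrightarrow> h i = fine_step"
  using x_left[of i] x_left[of "i + 1"] by (simp add: hm_def algebra_simps)

lemma h_middle:
  assumes "n \<le> i" "i < 2 * n"
  shows "h i = fine_step + p * (3 * (real i - real n)\<^sup>2 + 3 * (real i - real n) + 1) / real N ^ 3"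
proof -
  define a where "a = real i - real n"
  have "h i = fine_step + p * (((a + 1) / real N) ^ 3 - (a / real N) ^ 3)"
    using x_middle[of i] x_middle[of "i + 1"] assms by (simp add: hm_def a_def algebra_simps)
  moreover have "((a + 1) / real N) ^ 3 - (a / real N) ^ 3 = ((a + 1) ^ 3 - a ^ 3) / real N ^ 3"
    by (simp only: power_divide diff_divide_distrib)
  moreover have "(a + 1) ^ 3 - a ^ 3 = 3 * a\<^sup>2 + 3 * a + 1"
    by (simp add: power2_eq_square power3_eq_cube algebra_simps)
  ultimately show ?thesis by (simp add: a_def)
qed

lemma h_reflect:
  assumes "i < N"
  shows "h (N - 1 - i) = h i"
proof -
  have "N - 1 - i + 1 = N - i" "N - 1 - i = N - (i + 1)" using assms by auto
  then have "h (N - 1 - i) = x (N - i) - x (N - (i + 1))" unfolding hm_def by metis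
  then show ?thesis using x_reflect[of i] x_reflect[of "i + 1"] assms by (simp add: hm_def)
qed

lemma h_all_of_left_half:
  assumes "\<And>i. i < 2 * n \<Longrightarrow> P (h i)" and "i < N"
  shows "P (h i)"
proof (cases "i < 2 * n")
  case False
  then show ?thesis using assms(1)[of "N - 1 - i"] h_reflect[of i] assms(2) N_eq by auto
qed (use assms in auto)

lemma fine_step_le_h:
  assumes "i < N"
  shows "fine_step \<le> h i"
proof (rule h_all_of_left_half[OF _ assms])
  fix i
  assume "i < 2 * n"
  then show "fine_step \<le> h i"
    using h_left[of i] h_middle[of i] p_bounds by (cases "i < n") auto
qed

lemma h_pos: "i < N \<Longrightarrow> 0 < h i"
  using fine_step_le_h fine_step_pos by force

lemma h_le:
  assumes "i < N"
  shows "h i \<le> 7 / real N"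
proof (rule h_all_of_left_half[OF _ assms])
  fix i
  assume left_half: "i < 2 * n"
  show "h i \<le> 7 / real N"
  proof (cases "i < n")
    case True
    have "1 / real N \<le> 7 / real N" by (intro divide_right_mono) auto
    then show ?thesis using h_left[OF True] fine_step_le by simp
  next
    case False
    define j where "j = real i - real n"
    have j_bounds: "0 \<le> j" "j + 1 \<le> real n" using left_half False by (auto simp: j_def)
    have "3 * j\<^sup>2 + 3 * j + 1 \<le> 3 * (j + 1)\<^sup>2"
      using j_bounds
      by (simp add: power2_eq_square algebra_simps)
    also have "\<dots> \<le> 3 * (real n)\<^sup>2" using j_bounds by (intro mult_left_mono power_mono) auto
    finally have "p * (3 * j\<^sup>2 + 3 * j + 1) \<le> 32 * (3 * (real n)\<^sup>2)"
      using p_bounds j_bounds by (intro mult_mono) auto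
    then have "p * (3 * j\<^sup>2 + 3 * j + 1) / real N ^ 3 \<le> 32 * (3 * (real n)\<^sup>2) / real N ^ 3"
      by (intro divide_right_mono) auto
    also have "\<dots> = 6 / real N" using n_pos by (simp add: real_N_eq power2_eq_square power3_eq_cube)
    finally show ?thesis using h_middle[of i] left_half False fine_step_le by (simp add: j_def)
  qed
qed

lemma h_outer:
  assumes "i < n \<or> 3 * n \<le> i" "i < N"
  shows "h i = fine_step"
  using assms h_left[of i] h_left[of "N - 1 - i"] h_reflect[of i] N_eq by auto

lemma h_diff_middle:
  assumes "n < i" "i < 2 * n"
  shows "h i - h (i - 1) = 6 * p * (real i - real n) / real N ^ 3"
proof -
  define j where "j = real i - real n"
  have "real (i - 1) - real n = j - 1" using assms by (auto simp: j_def)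
  then have "h i - h (i - 1) = p * (3 * j\<^sup>2 + 3 * j + 1) / real N ^ 3
      - p * (3 * (j - 1)\<^sup>2 + 3 * (j - 1) + 1) / real N ^ 3"
    using h_middle[of i] h_middle[of "i - 1"] assms by (simp add: j_def)
  also have "\<dots> = 6 * p * j / real N ^ 3"
    by (simp add: diff_divide_distrib[symmetric] power2_eq_square algebra_simps)
  finally show ?thesis by (simp add: j_def)
qed

lemma h_diff_le_left_half:
  assumes "n \<le> i" "i < 2 * n"
  shows "\<bar>h i - h (i - 1)\<bar> \<le> 48 / (real N)\<^sup>2"
proof -
  have "\<bar>h i - h (i - 1)\<bar> \<le> 32 * (6 * real n) / real N ^ 3"
  proof (cases "i = n")
    case True
    then have "h i - h (i - 1) = p / real N ^ 3" using h_middle[of i] h_left[of "i - 1"] n_pos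
      by simp
    moreover have "p \<le> 32 * (6 * real n)" using p_bounds n_pos by linarith
    ultimately show ?thesis using p_bounds by (simp add: divide_right_mono)
  next
    case False
    then have "h i - h (i - 1) = p * (6 * (real i - real n)) / real N ^ 3"
      using h_diff_middle[of i] assms by simp
    moreover have "p * (6 * (real i - real n)) \<le> 32 * (6 * real n)"
      using p_bounds assms by (intro mult_mono) auto
    ultimately show ?thesis using p_bounds assms by (simp add: divide_right_mono)
  qed
  also have "\<dots> = 48 / (real N)\<^sup>2"
    using n_pos
    by (simp add: real_N_eq power2_eq_square power3_eq_cube)
  finally show ?thesis .
qed

lemma h_diff_le:
  assumes "n \<le> i" "i \<le> 3 * n"
  shows "\<bar>h i - h (i - 1)\<bar> \<le> 48 / (real N)\<^sup>2"
proof -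
  consider (left) "i < 2 * n" | (centre) "i = 2 * n" | (right) "2 * n < i" by linarith
  then show ?thesis
  proof cases
    case left
    then show ?thesis using h_diff_le_left_half assms by simp
  next
    case centre
    then have "N - 1 - i = i - 1" using N_eq by simp
    then have "h (i - 1) = h i" using centre h_reflect[of i] N_eq n_pos by simp
    then show ?thesis by simp
  next
    case right
    have "h (N - i) = h (i - 1)" "h (N - i - 1) = h i"
      using h_reflect[of i] h_reflect[of "i - 1"] right assms N_eq n_pos
      by (auto simp: diff_commute)
    then show ?thesis
      using h_diff_le_left_half[of "N - i"] right assms N_eq by (simp add: abs_minus_commute)
  qed
qed

lemma x_mono:
  assumes "i \<le> j" "j \<le> N"
  shows "x i \<le> x j"
  using assms
proof (induction j rule: dec_induct)
  case (step j)
  then show ?case using h_pos[of j] by (simp add: hm_def)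
qed simp

lemma x_0: "x 0 = 0"
  using x_left[of 0] by simp

lemma x_n: "x n = lam"
  using x_left[of n] n_pos by (simp add: fine_step_def)

lemma x_N: "x N = 1"
  using x_reflect[of 0] x_0 by simp

lemma x_in_unit_interval: "i \<le> N \<Longrightarrow> x i \<in> {0..1}"
  using x_mono[of 0 i] x_mono[of i N] x_0 x_N by auto

lemma x_pred: "0 < i \<Longrightarrow> x (i - 1) = x i - h (i - 1)"
  by (simp add: hm_def)

lemma x_succ: "x (i + 1) = x i + h i"
  by (simp add: hm_def)

lemma stencil_subset:
  assumes "0 < i" "i < N"
  shows "{x i - h (i - 1)..x i + h i} \<subseteq> {0..1}"
  using x_in_unit_interval[of "i - 1"] x_in_unit_interval[of "i + 1"] x_pred[of i] x_succ[of i] assms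
  by auto

lemma stencil_subset_middle:
  assumes "n \<le> i" "i \<le> 3 * n"
  shows "{x i - h (i - 1)..x i + h i} \<subseteq> {lam - fine_step..1 - (lam - fine_step)}"
proof -
  have "x (n - 1) = lam - fine_step"
    using x_left[of "n - 1"] n_pos by (simp add: fine_step_def field_simps)
  moreover have "x (n - 1) \<le> x (i - 1)" using assms N_eq by (intro x_mono) auto
  moreover have "x (i + 1) \<le> x (N - (n - 1))" using assms N_eq n_pos by (intro x_mono) auto
  moreover have "x (N - (n - 1)) = 1 - x (n - 1)" using N_eq by (intro x_reflect) auto
  ultimately show ?thesis using x_pred[of i] x_succ[of i] assms n_pos by auto
qed

lemma exp_lam: "exp (- (sqrt m * lam / eps)) = 1 / (real N)\<^sup>2"
proof -
  have "sqrt m * lam / eps = 2 * ln (real N)" using m_pos eps_pos by (simp add: lam_eq)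
  then have "exp (- (sqrt m * lam / eps)) = 1 / (exp (ln (real N)))\<^sup>2"
    by (simp add: exp_minus exp_double inverse_eq_divide)
  then show ?thesis using N_pos by simp
qed

lemma exp_minus_le_outside_layer:
  assumes "lam - fine_step \<le> t"
  shows "exp (- (sqrt m * t / eps)) \<le> exp 8 / (real N)\<^sup>2"
proof -
  have "sqrt m * (lam - fine_step) / eps \<le> sqrt m * t / eps"
    using assms m_pos eps_pos by (intro divide_right_mono mult_left_mono) auto
  then have "- (sqrt m * t / eps) \<le> 8 + - (sqrt m * lam / eps)"
    using scaled_fine_step_le by (simp add: right_diff_distrib diff_divide_distrib)
  then have "exp (- (sqrt m * t / eps)) \<le> exp (8 + - (sqrt m * lam / eps))" by simp
  then show ?thesis unfolding exp_add exp_lam by simp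
qed

lemma layer_le_middle:
  assumes "t \<in> {lam - fine_step..1 - (lam - fine_step)}"
  shows "layer m eps t \<le> 2 * exp 8 / (real N)\<^sup>2"
  using exp_minus_le_outside_layer[of t] exp_minus_le_outside_layer[of "1 - t"] assms
  by (simp add: layer_def)

end

section \<open>The barrier function\<close>

definition kappa :: "real \<Rightarrow> real \<Rightarrow> real" where
  "kappa m gam = sqrt m / sqrt gam"

definition decay_const :: "real \<Rightarrow> real \<Rightarrow> real" where
  "decay_const m gam = 2 * exp (24 / kappa m gam)"

definition kink_const :: "real \<Rightarrow> real \<Rightarrow> real" where
  "kink_const m gam = (4 + 128 / kappa m gam) * decay_const m gam"

locale shishkin_barrier = shishkin_mesh +
  fixes gam :: real
  assumes m_le_gam: "m \<le> gam"
begin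

text \<open>Where the mesh is uniform, \<open>mu ^ i\<close> is an eigenfunction of the difference operator. The
  factor \<open>3 / 4\<close> in \<open>rho\<close> leaves room for a strictly negative eigenvalue; anything strictly between
  \<open>1 / 2\<close> and \<open>1\<close> would do, the lower limit being needed for the decay up to \<open>i = n\<close>.\<close>

definition sigma :: real where "sigma = sqrt gam / eps * fine_step / 2"

definition rho :: real where "rho = 3 / 4 * (kappa m gam * tanh sigma)"

definition mu :: real where "mu = (1 - rho) / (1 + rho)"

definition barrier :: "nat \<Rightarrow> real" where
  "barrier i = mu ^ min (min i (N - i)) n"

abbreviation barrier_op :: "(nat \<Rightarrow> real) \<Rightarrow> nat \<Rightarrow> real" where
  "barrier_op \<equiv> linearised_op (sqrt gam / eps) gam h (\<lambda>_. m)"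

lemma gam_pos: "0 < gam"
  using m_pos m_le_gam by simp

lemma beta_pos: "0 < sqrt gam / eps"
  using gam_pos eps_pos by simp

lemma kappa_bounds: "0 < kappa m gam" "kappa m gam \<le> 1"
  using m_pos m_le_gam gam_pos by (auto simp: kappa_def)

lemma kappa_square: "(kappa m gam)\<^sup>2 = m / gam"
  using m_pos gam_pos by (simp add: kappa_def power_divide)

lemma sigma_pos: "0 < sigma"
  using fine_step_pos eps_pos gam_pos by (simp add: sigma_def)

lemma sigma_eq: "sigma = 4 * ln (real N) / (kappa m gam * real N)"
  using eps_pos m_pos gam_pos by (simp add: sigma_def fine_step_eq kappa_def field_simps)

lemma sigma_le: "sigma \<le> 4 / kappa m gam"
proof -
  have "sigma = 4 / kappa m gam * (ln (real N) / real N)" by (simp add: sigma_eq)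
  also have "\<dots> \<le> 4 / kappa m gam * 1"
    using ln_bound[of "real N"] N_pos kappa_bounds by (intro mult_left_mono) auto
  finally show ?thesis by simp
qed

lemma rho_bounds: "0 < rho" "rho \<le> 3 / 4" "rho \<le> sigma" "rho \<le> tanh (kappa m gam * sigma)"
proof -
  have tanh_bounds: "0 < tanh sigma" "tanh sigma < 1" "tanh sigma \<le> sigma"
    using sigma_pos tanh_real_lt_1 tanh_real_le_self[of sigma] by auto
  have product_bounds: "0 < kappa m gam * tanh sigma" "kappa m gam * tanh sigma \<le> 1 * tanh sigma"
    using kappa_bounds tanh_bounds by (auto intro: mult_right_mono)
  show "0 < rho" "rho \<le> 3 / 4" "rho \<le> sigma"
    using tanh_bounds product_bounds by (auto simp: rho_def)
  show "rho \<le> tanh (kappa m gam * sigma)"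
    using mult_tanh_real_le[of "kappa m gam" sigma] kappa_bounds sigma_pos product_bounds(1)
    unfolding rho_def by linarith
qed

lemma mu_bounds: "0 < mu" "mu \<le> 1"
  using rho_bounds by (auto simp: mu_def)

lemma one_minus_mu_eq: "1 - mu = rho * (1 + mu)"
  using rho_bounds by (simp add: mu_def field_simps)

lemma exp_le_mu_power:
  assumes "i \<le> n"
  shows "exp (- (sqrt m * x i / eps)) \<le> mu ^ i"
proof -
  have "sqrt m * fine_step / eps = 2 * (kappa m gam * sigma)"
    using gam_pos by (simp add: kappa_def sigma_def)
  then have "sqrt m * x i / eps = real i * (2 * (kappa m gam * sigma))"
    using x_left[OF assms] by (simp flip: times_divide_eq_right)
  then have "exp (- (sqrt m * x i / eps)) = exp (real i * (- 2 * (kappa m gam * sigma)))" by simp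
  also have "\<dots> = exp (- 2 * (kappa m gam * sigma)) ^ i" by (rule exp_of_nat_mult)
  also have "\<dots> \<le> mu ^ i"
    unfolding mu_def exp_minus_double_eq_tanh
    using moebius_antimono[of rho "tanh (kappa m gam * sigma)"] rho_bounds tanh_real_lt_1
    by (intro power_mono) (auto simp: less_imp_le)
  finally show ?thesis .
qed

lemma barrier_reflect: "i \<le> N \<Longrightarrow> barrier (N - i) = barrier i"
  by (simp add: barrier_def min.commute)

lemma barrier_bounds: "0 < barrier i" "barrier i \<le> 1"
  using mu_bounds by (auto simp: barrier_def power_le_one)

lemma barrier_left: "i \<le> n \<Longrightarrow> barrier i = mu ^ i"
  using N_eq by (simp add: barrier_def min_def)

lemma barrier_middle:
  assumes "n \<le> i" "i \<le> 3 * n"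
  shows "barrier i = mu ^ n"
proof -
  have "min (min i (N - i)) n = n" using assms N_eq by linarith
  then show ?thesis by (simp add: barrier_def)
qed

lemma layer_le_barrier:
  assumes "i \<le> n \<or> 3 * n \<le> i" "i \<le> N"
  shows "layer m eps (x i) \<le> barrier i + 1 / (real N)\<^sup>2"
proof -
  have left: "layer m eps (x j) \<le> barrier j + 1 / (real N)\<^sup>2" if "j \<le> n" for j
  proof -
    have "x j \<le> lam" unfolding x_n[symmetric] using that N_eq by (intro x_mono) auto
    then have "lam \<le> 1 - x j" using lam_bounds by linarith
    then have "sqrt m * lam / eps \<le> sqrt m * (1 - x j) / eps"
      using m_pos eps_pos by (intro divide_right_mono mult_left_mono) auto
    then have "exp (- (sqrt m * (1 - x j) / eps)) \<le> 1 / (real N)\<^sup>2"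
      unfolding exp_lam[symmetric] by simp
    then show ?thesis
      using exp_le_mu_power[OF that] barrier_left[OF that] by (simp add: layer_def)
  qed
  show ?thesis
  proof (cases "i \<le> n")
    case False
    then have "N - i \<le> n" using assms N_eq by auto
    from left[OF this] show ?thesis
      using barrier_reflect[OF assms(2)] x_reflect[OF assms(2)] by (simp add: layer_reflect)
  qed (use left in auto)
qed

lemma barrier_op_reflect:
  assumes symmetric: "\<And>j. j \<le> N \<Longrightarrow> w (N - j) = w j" and i_inner: "0 < i" "i < N"
  shows "barrier_op w (N - i) = barrier_op w i"
proof -
  have "N - i - 1 = N - 1 - i" "N - i = N - 1 - (i - 1)" using i_inner by auto
  then have steps: "h (N - i - 1) = h i" "h (N - i) = h (i - 1)"
    using h_reflect[of i] h_reflect[of "i - 1"] i_inner by (simp_all only: less_imp_diff_less)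
  have "N - i - 1 = N - (i + 1)" "N - i + 1 = N - (i - 1)" using i_inner by auto
  then have "w (N - i - 1) = w (i + 1)" "w (N - i) = w i" "w (N - i + 1) = w (i - 1)"
    using symmetric[of "i + 1"] symmetric[of i] symmetric[of "i - 1"] i_inner by auto
  then show ?thesis
    unfolding linearised_op_def mesh_op_def stencil_sum_def steps
    by (subst scheme_op_commute) (simp add: add_ac)
qed

lemma scheme_op_geometric_le:
  assumes "0 \<le> c"
  shows "scheme_op (sqrt gam / eps) fine_step fine_step c (mu * c) (mu\<^sup>2 * c)
      - m / gam * (c + 2 * (mu * c) + mu\<^sup>2 * c) \<le> - (7 / 4 * (m / gam)) * (mu * c)"
proof -
  have "scheme_op (sqrt gam / eps) fine_step fine_step c (mu * c) (mu\<^sup>2 * c)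
      = (1 - mu)\<^sup>2 * c / (tanh sigma)\<^sup>2"
    unfolding scheme_op_uniform[OF beta_pos fine_step_pos] sigma_def
    by (simp add: power2_eq_square algebra_simps)
  also have "\<dots> = 9 / 16 * (m / gam) * ((1 + mu)\<^sup>2 * c)"
    unfolding one_minus_mu_eq kappa_square[symmetric]
    using sigma_pos by (simp add: rho_def power_mult_distrib power_divide)
  finally have "scheme_op (sqrt gam / eps) fine_step fine_step c (mu * c) (mu\<^sup>2 * c)
      - m / gam * (c + 2 * (mu * c) + mu\<^sup>2 * c) = - (7 / 16 * (m / gam)) * ((1 + mu)\<^sup>2 * c)"
    by (simp add: power2_eq_square algebra_simps)
  also have "\<dots> \<le> - (7 / 16 * (m / gam)) * (4 * (mu * c))"
  proof (rule mult_left_mono_neg)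
    have "0 \<le> (1 - mu)\<^sup>2 * c" using assms by simp
    then show "4 * (mu * c) \<le> (1 + mu)\<^sup>2 * c" by (simp add: power2_eq_square algebra_simps)
  qed (use m_pos gam_pos in auto)
  finally show ?thesis by (simp add: mult_ac)
qed

lemma barrier_op_fine:
  assumes "0 < i" "i < N" "i < n \<or> 3 * n < i"
  shows "barrier_op barrier i \<le> - (7 / 4 * (m / gam)) * barrier i"
proof -
  have left: "barrier_op barrier i \<le> - (7 / 4 * (m / gam)) * barrier i"
    if i_inner: "0 < i" "i < n" for i
  proof -
    have grid_values: "barrier (i - 1) = mu ^ (i - 1)" "barrier i = mu * mu ^ (i - 1)"
      "barrier (i + 1) = mu\<^sup>2 * mu ^ (i - 1)"
      using i_inner barrier_left[of i] barrier_left[of "i - 1"] barrier_left[of "i + 1"]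
      by (auto simp: power_eq_if[of mu i] power2_eq_square)
    have steps: "h (i - 1) = fine_step" "h i = fine_step" using i_inner h_left by auto
    have "barrier_op barrier i
        = scheme_op (sqrt gam / eps) fine_step fine_step (mu ^ (i - 1)) (mu * mu ^ (i - 1))
          (mu\<^sup>2 * mu ^ (i - 1))
          - m / gam * (mu ^ (i - 1) + 2 * (mu * mu ^ (i - 1)) + mu\<^sup>2 * mu ^ (i - 1))"
      unfolding linearised_op_def mesh_op_def stencil_sum_def grid_values steps
      by (simp add: algebra_simps add_divide_distrib)
    then show ?thesis
      using scheme_op_geometric_le[of "mu ^ (i - 1)"] mu_bounds unfolding grid_values by simp
  qed
  show ?thesis
  proof (cases "i < n")
    case False
    then have "0 < N - i" "N - i < n" using assms N_eq by auto
    from left[OF this] show ?thesis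
      using barrier_op_reflect[of barrier i] barrier_reflect assms by auto
  qed (use left assms in auto)
qed

lemma one_minus_mu_le: "1 - mu \<le> 8 * sigma * mu"
proof -
  have "1 - mu = 2 * rho / (1 + rho)" using rho_bounds by (simp add: mu_def field_simps)
  also have "\<dots> = 2 * rho / (1 - rho) * mu" using rho_bounds by (simp add: mu_def)
  also have "\<dots> \<le> 8 * sigma * mu"
  proof (rule mult_right_mono)
    have "2 * rho / (1 - rho) \<le> 2 * rho / (1 / 4)" using rho_bounds by (intro divide_left_mono) auto
    then show "2 * rho / (1 - rho) \<le> 8 * sigma" using rho_bounds(3) by simp
  qed (use mu_bounds in simp)
  finally show ?thesis .
qed

lemma barrier_op_n_le: "barrier_op barrier n \<le> (16 / sigma + 8 * sigma) * mu ^ n"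
proof -
  define weight where "weight = scheme_weight (sqrt gam / eps) fine_step (h n)"
  have steps: "h (n - 1) = fine_step" "0 < h n"
    using h_left[of "n - 1"] n_pos h_pos[of n] N_eq by auto
  have weight_bounds: "0 \<le> weight" "weight \<le> 2 / sigma\<^sup>2"
    using scheme_weight_pos[OF beta_pos fine_step_pos steps(2)]
      scheme_weight_le[OF beta_pos fine_step_pos steps(2)]
    by (auto simp: weight_def sigma_def power_divide)
  have "mu * mu ^ (n - 1) = mu ^ n" using n_pos by (simp add: power_eq_if[of mu n])
  have grid_values: "barrier (n - 1) = mu ^ (n - 1)" "barrier n = mu ^ n" "barrier (n + 1) = mu ^ n"
    using n_pos barrier_left[of n] barrier_left[of "n - 1"] barrier_middle[of "n + 1"] by auto
  have "0 \<le> stencil_sum (\<lambda>j. m * barrier j) n / gam"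
    using m_pos gam_pos barrier_bounds(1) by (simp add: stencil_sum_def less_imp_le)
  then have "barrier_op barrier n \<le> (weight + 1) * (mu ^ (n - 1) - mu ^ n)"
    unfolding linearised_op_def mesh_op_def scheme_op_def grid_values steps weight_def by simp
  also have "\<dots> \<le> (2 / sigma\<^sup>2 + 1) * (8 * sigma * mu ^ n)"
  proof (rule mult_mono)
    have "(1 - mu) * mu ^ (n - 1) \<le> 8 * sigma * mu * mu ^ (n - 1)"
      using one_minus_mu_le mu_bounds by (intro mult_right_mono) auto
    then show "mu ^ (n - 1) - mu ^ n \<le> 8 * sigma * mu ^ n"
      using \<open>mu * mu ^ (n - 1) = mu ^ n\<close> by (simp add: left_diff_distrib mult.assoc)
    show "0 \<le> mu ^ (n - 1) - mu ^ n" using mu_bounds by (simp add: power_decreasing)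
  qed (use weight_bounds in auto)
  also have "\<dots> = (16 / sigma + 8 * sigma) * mu ^ n"
    using sigma_pos by (simp add: field_simps power2_eq_square)
  finally show ?thesis .
qed

lemma barrier_op_transition_le:
  assumes "i = n \<or> i = 3 * n"
  shows "barrier_op barrier i \<le> (16 / sigma + 8 * sigma) * mu ^ n"
proof (cases "i = n")
  case False
  then have "i = N - n" using assms N_eq by auto
  then show ?thesis
    using barrier_op_n_le barrier_op_reflect[of barrier n] barrier_reflect n_pos N_eq by auto
qed (use barrier_op_n_le in simp)

lemma barrier_op_middle_nonpos:
  assumes "n < i" "i < 3 * n"
  shows "barrier_op barrier i \<le> 0"
proof -
  have "barrier (i - 1) = mu ^ n" "barrier i = mu ^ n" "barrier (i + 1) = mu ^ n"
    using assms by (auto intro!: barrier_middle)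
  then show ?thesis
    using m_pos gam_pos mu_bounds
    by (simp add: linearised_op_def mesh_op_def scheme_op_def stencil_sum_def)
qed

lemma ln_N_mult_sigma_le: "ln (real N) * sigma \<le> 16 / kappa m gam"
proof -
  have "ln (real N) * sigma = 4 / kappa m gam * ((ln (real N))\<^sup>2 / real N)"
    by (simp add: sigma_eq power2_eq_square)
  also have "\<dots> \<le> 4 / kappa m gam * 4"
    using ln_square_le[of "real N"] N_ge_4 kappa_bounds
    by (intro mult_left_mono) (auto simp: divide_le_eq)
  finally show ?thesis by simp
qed

lemma mu_power_n_le_exp: "mu ^ n \<le> exp (24 / kappa m gam - 3 / 2 * ln (real N))"
proof -
  let ?c = "3 / 8 * (kappa m gam * real N)"
  have "kappa m gam * real N * sigma = 4 * ln (real N)"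
    using kappa_bounds N_pos by (simp add: sigma_eq)
  then have "?c * (sigma - sigma\<^sup>2) = 3 / 2 * ln (real N) - 3 / 2 * (ln (real N) * sigma)"
    by (simp add: power2_eq_square algebra_simps)
  moreover have "?c * (sigma - sigma\<^sup>2) \<le> ?c * tanh sigma"
    using tanh_real_ge_diff_square[of sigma] sigma_pos kappa_bounds by (intro mult_left_mono) auto
  moreover have "real n * (2 * rho) = ?c * tanh sigma" by (simp add: rho_def real_N_eq)
  ultimately have "real n * (- 2 * rho) \<le> 24 / kappa m gam - 3 / 2 * ln (real N)"
    using ln_N_mult_sigma_le by simp
  moreover have "mu ^ n \<le> exp (- 2 * rho) ^ n"
    unfolding exp_minus_double_eq_tanh mu_def
    using moebius_antimono[of "tanh rho" rho] tanh_real_le_self[of rho] rho_bounds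
    by (intro power_mono) auto
  ultimately show ?thesis
    unfolding exp_of_nat_mult[symmetric] by (meson exp_le_cancel_iff order_trans)
qed

lemma N_ln_N_mu_power_le: "real N * ln (real N) * mu ^ n \<le> decay_const m gam"
proof -
  have "real N * ln (real N) * mu ^ n
      \<le> real N * ln (real N) * exp (24 / kappa m gam - 3 / 2 * ln (real N))"
    using ln_N_gt_1 mu_power_n_le_exp by (intro mult_left_mono) auto
  also have "\<dots> = exp (24 / kappa m gam) * (ln (real N) * exp (- (ln (real N) / 2)))"
  proof -
    have "24 / kappa m gam - 3 / 2 * ln (real N)
        = 24 / kappa m gam + (- ln (real N) + - (ln (real N) / 2))" by simp
    then have "exp (24 / kappa m gam - 3 / 2 * ln (real N))
        = exp (24 / kappa m gam) * (exp (- ln (real N)) * exp (- (ln (real N) / 2)))"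
      by (simp only: exp_add)
    then show ?thesis using N_pos by (simp add: exp_minus)
  qed
  also have "\<dots> \<le> exp (24 / kappa m gam) * 2"
  proof (rule mult_left_mono)
    have "ln (real N) / 2 \<le> exp (ln (real N) / 2)"
      using exp_ge_add_one_self[of "ln (real N) / 2"] by linarith
    then show "ln (real N) * exp (- (ln (real N) / 2)) \<le> 2" by (simp add: exp_minus field_simps)
  qed simp
  finally show ?thesis by (simp add: decay_const_def)
qed

lemma ln_square_mult_barrier_middle_le:
  assumes "n \<le> i" "i \<le> 3 * n"
  shows "(ln (real N))\<^sup>2 * barrier i \<le> decay_const m gam"
proof -
  have "(ln (real N))\<^sup>2 * mu ^ n \<le> real N * ln (real N) * mu ^ n"
    unfolding power2_eq_square using mu_bounds ln_bound[of "real N"] ln_N_gt_1 N_pos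
    by (intro mult_right_mono) auto
  then show ?thesis using N_ln_N_mu_power_le barrier_middle[OF assms] by simp
qed

lemma ln_square_mult_kink_le:
  "(ln (real N))\<^sup>2 * ((16 / sigma + 8 * sigma) * mu ^ n) \<le> kink_const m gam"
proof -
  let ?k = "kappa m gam" and ?l = "ln (real N)"
  have "8 * (?l * sigma) * ?l \<le> 128 / ?k * ?l"
    using ln_N_mult_sigma_le ln_N_gt_1 by (intro mult_right_mono) auto
  also have "\<dots> \<le> 128 / ?k * (real N * ?l)"
    using ln_N_gt_1 kappa_bounds N_ge_4 by (intro mult_left_mono) auto
  finally have "8 * (?l * sigma) * ?l \<le> 128 / ?k * (real N * ?l)" .
  moreover have "?k * (real N * ?l) \<le> 1 * (real N * ?l)"
    using kappa_bounds ln_N_gt_1 by (intro mult_right_mono) auto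
  moreover have "?l\<^sup>2 * (16 / sigma + 8 * sigma) = 4 * (?k * (real N * ?l)) + 8 * (?l * sigma) * ?l"
    using ln_N_gt_1 kappa_bounds by (simp add: sigma_eq field_simps power2_eq_square)
  ultimately have "?l\<^sup>2 * (16 / sigma + 8 * sigma) \<le> (4 + 128 / ?k) * (real N * ?l)"
    unfolding distrib_right by linarith
  then have "?l\<^sup>2 * (16 / sigma + 8 * sigma) * mu ^ n \<le> (4 + 128 / ?k) * (real N * ?l) * mu ^ n"
    using mu_bounds by (intro mult_right_mono) auto
  also have "\<dots> = (4 + 128 / ?k) * (real N * ?l * mu ^ n)" by simp
  also have "\<dots> \<le> kink_const m gam"
    unfolding kink_const_def using N_ln_N_mu_power_le kappa_bounds by (intro mult_left_mono) auto
  finally show ?thesis by (simp add: mult.assoc)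
qed

end

section \<open>Error analysis\<close>

context reaction_term
begin

definition envelope_const :: "real \<Rightarrow> real" where
  "envelope_const C0 = C0\<^sup>2 + 2 * exp 8"

definition coarse_const :: "real \<Rightarrow> real" where
  "coarse_const C0 = 338 * a_priori_const
     + (4 + 20 / gam + 16 / sqrt gam) * (a_priori_const * envelope_const C0)"

definition fine_const :: "real \<Rightarrow> real" where
  "fine_const C0 = 64 / m * (1 + (4 + 2 * (4 / kappa m gam)\<^sup>2) / gam)
     * (a_priori_const * envelope_const C0)"

definition truncation_const :: "real \<Rightarrow> real" where
  "truncation_const C0 = coarse_const C0 + fine_const C0"

definition layer_weight :: "real \<Rightarrow> real" where
  "layer_weight C0 = truncation_const C0 / (7 / 4 * (m / gam))"

definition base_weight :: "real \<Rightarrow> real" where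
  "base_weight C0 = (truncation_const C0 + layer_weight C0 * kink_const m gam) / (4 * (m / gam))"

definition error_const :: "real \<Rightarrow> real" where
  "error_const C0 = 1 + base_weight C0 + layer_weight C0 * (1 + decay_const m gam)"

lemma envelope_const_nonneg: "0 \<le> envelope_const C0"
  by (simp add: envelope_const_def)

lemma truncation_const_bounds:
  "0 \<le> truncation_const C0" "coarse_const C0 \<le> truncation_const C0"
  "fine_const C0 \<le> truncation_const C0"
proof -
  have "0 \<le> coarse_const C0" "0 \<le> fine_const C0"
    using a_priori_const_bounds(1) envelope_const_nonneg gam_pos m_pos
    by (auto simp: coarse_const_def fine_const_def intro!: add_nonneg_nonneg mult_nonneg_nonneg)
  then show "0 \<le> truncation_const C0" "coarse_const C0 \<le> truncation_const C0"
    "fine_const C0 \<le> truncation_const C0"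
    by (auto simp: truncation_const_def)
qed

lemma decay_const_nonneg: "0 \<le> decay_const m gam"
  by (simp add: decay_const_def)

lemma kink_const_nonneg: "0 \<le> kink_const m gam"
  using m_pos gam_pos decay_const_nonneg
  by (auto simp: kink_const_def kappa_def intro!: mult_nonneg_nonneg add_nonneg_nonneg)

lemma layer_weight_nonneg: "0 \<le> layer_weight C0"
  using truncation_const_bounds(1) m_pos gam_pos by (simp add: layer_weight_def)

lemma base_weight_nonneg: "0 \<le> base_weight C0"
  using truncation_const_bounds(1) layer_weight_nonneg kink_const_nonneg m_pos gam_pos
  by (simp add: base_weight_def)

lemma error_const_pos: "0 < error_const C0"
  using base_weight_nonneg layer_weight_nonneg decay_const_nonneg
  by (auto simp: error_const_def intro!: add_pos_nonneg mult_nonneg_nonneg)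

end

context shishkin_barrier
begin

lemma scheme_imp_mesh_op:
  assumes i_inner: "0 < i" "i < N"
    and scheme: "gam / (Ddm gam m eps N i + Ddm gam m eps N (i+1)) *
          ((3 * am gam m eps N i + dm gam m eps N i + Ddm gam m eps N (i+1)) * (u (i - 1) - u i)
           - (3 * am gam m eps N (i+1) + dm gam m eps N (i+1) + Ddm gam m eps N i) * (u i - u (i + 1))
           - F / gam * (Ddm gam m eps N i + Ddm gam m eps N (i+1))) = 0"
  shows "mesh_op (sqrt gam / eps) h u i = F / gam"
proof -
  let ?b = "sqrt gam / eps"
  define a a' t t' where "a = am gam m eps N i" and "a' = am gam m eps N (i + 1)"
    and "t = tanh (?b * h (i - 1) / 2)" and "t' = tanh (?b * h i / 2)"
  have steps: "0 < h (i - 1)" "0 < h i" using h_pos i_inner by auto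
  have nonzero: "?b * h (i - 1) \<noteq> 0" "?b * h i \<noteq> 0" using beta_pos steps by auto
  have differences: "Ddm gam m eps N i = t" "Ddm gam m eps N (i + 1) = t'"
    unfolding Ddm_def dm_def am_def t_def t'_def
    using nonzero[THEN coth_minus_csch_eq_tanh_half] by auto
  then have cotangents: "dm gam m eps N i = a + t" "dm gam m eps N (i + 1) = a' + t'"
    unfolding Ddm_def a_def a'_def by auto
  have "0 < t + t'" using gam_pos eps_pos steps unfolding t_def t'_def by (intro add_pos_pos) auto
  then have "gam / (t + t') \<noteq> 0" using gam_pos by simp
  with scheme have "(3 * a + (a + t) + t') * (u (i - 1) - u i)
      - (3 * a' + (a' + t') + t) * (u i - u (i + 1)) - F / gam * (t + t') = 0"
    unfolding differences cotangents a_def[symmetric] a'_def[symmetric]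
    by (simp only: mult_eq_0_iff simp_thms)
  moreover define D where "D = t + t'"
  ultimately have "(4 * a + D) * (u (i - 1) - u i) + (4 * a' + D) * (u (i + 1) - u i) = F / gam * D"
    by (simp add: algebra_simps)
  moreover have weights: "scheme_weight ?b (h (i - 1)) (h i) = 4 * a / D"
    "scheme_weight ?b (h i) (h (i - 1)) = 4 * a' / D"
    unfolding scheme_weight_def a_def a'_def am_def t_def t'_def D_def
    by (simp_all add: add.commute)
  have "mesh_op ?b h u i = ((4 * a + D) * (u (i - 1) - u i) + (4 * a' + D) * (u (i + 1) - u i)) / D"
    using \<open>0 < t + t'\<close> unfolding mesh_op_def scheme_op_def weights D_def[symmetric]
    by (simp add: field_simps)
  ultimately show ?thesis using \<open>0 < t + t'\<close> unfolding D_def[symmetric] by simp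
qed

lemma barrier_op_const_plus: "barrier_op (\<lambda>j. a + c * u j) i = c * barrier_op u i - 4 * (m / gam) * a"
  by (simp add: linearised_op_def mesh_op_def scheme_op_def stencil_sum_def algebra_simps
      add_divide_distrib diff_divide_distrib)

end

locale discretised_bvp =
  singularly_perturbed_bvp f fx fy fxx fxy fyx fyy m gam eps y y' +
  mesh?: shishkin_barrier m eps N gam
  for f fx fy fxx fxy fyx fyy :: "real \<times> real \<Rightarrow> real" and m gam eps :: real
    and y y' :: "real \<Rightarrow> real" and N :: nat +
  fixes yb :: "nat \<Rightarrow> real" and C0 :: real
  assumes eps_le: "eps \<le> C0 / real N"
    and yb_boundary: "yb 0 = 0" "yb N = 0"
    and scheme: "\<And>i. 0 < i \<Longrightarrow> i < N \<Longrightarrow>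
      mesh_op (sqrt gam / eps) (hm m eps N) yb i = stencil_sum (\<lambda>j. f (xm m eps N j, yb j)) i / gam"
begin

lemma eps_square_le: "eps\<^sup>2 \<le> C0\<^sup>2 / (real N)\<^sup>2"
proof -
  have "eps\<^sup>2 \<le> (C0 / real N)\<^sup>2" using eps_le eps_pos by (intro power_mono) auto
  then show ?thesis by (simp add: power_divide)
qed

lemma truncation_error_middle_le:
  assumes i_middle: "n \<le> i" "i \<le> 3 * n"
  shows "\<bar>truncation_error (h (i - 1)) (h i) (x i)\<bar> \<le> coarse_const C0 / (real N)\<^sup>2"
proof -
  let ?hl = "h (i - 1)" and ?hr = "h i"
  have inner: "0 < i" "i < N" using i_middle n_pos N_eq by auto
  have steps: "0 < ?hl" "0 < ?hr" "?hl \<le> 7 / real N" "?hr \<le> 7 / real N"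
    using h_pos h_le inner by auto
  have "envelope m eps t \<le> envelope_const C0 / (real N)\<^sup>2" if "t \<in> {x i - ?hl..x i + ?hr}" for t
  proof -
    have "layer m eps t \<le> 2 * exp 8 / (real N)\<^sup>2"
      using stencil_subset_middle[OF i_middle] that by (intro layer_le_middle) blast
    then show ?thesis
      using eps_square_le by (simp add: envelope_def envelope_const_def add_divide_distrib)
  qed
  then have "\<bar>truncation_error ?hl ?hr (x i)\<bar> \<le> a_priori_const * (5 * \<bar>?hr - ?hl\<bar> + ?hl\<^sup>2 + ?hr\<^sup>2)
      + (4 + 20 / gam + 16 / sqrt gam) * (a_priori_const * (envelope_const C0 / (real N)\<^sup>2))"
    by (rule abs_truncation_error_le[OF steps(1,2) stencil_subset[OF inner]])
  also have "a_priori_const * (5 * \<bar>?hr - ?hl\<bar> + ?hl\<^sup>2 + ?hr\<^sup>2) \<le> a_priori_const * (338 / (real N)\<^sup>2)"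
  proof (rule mult_left_mono[OF _ a_priori_const_bounds(1)])
    have "?hl\<^sup>2 \<le> (7 / real N)\<^sup>2" "?hr\<^sup>2 \<le> (7 / real N)\<^sup>2" using steps by (auto intro!: power_mono)
    then show "5 * \<bar>?hr - ?hl\<bar> + ?hl\<^sup>2 + ?hr\<^sup>2 \<le> 338 / (real N)\<^sup>2"
      using h_diff_le[OF i_middle] by (simp add: power_divide)
  qed
  finally show ?thesis by (simp add: coarse_const_def add_divide_distrib mult_ac)
qed

lemma envelope_le_barrier:
  assumes i_fine: "0 < i" "i < N" "i < n \<or> 3 * n < i" and near: "\<bar>x i - t\<bar> \<le> fine_step"
  shows "envelope m eps t \<le> envelope_const C0 * (1 / (real N)\<^sup>2 + barrier i)"
proof -
  have "layer m eps t \<le> exp (sqrt m * fine_step / eps) * layer m eps (x i)"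
    using near m_pos eps_pos by (intro layer_le_exp_mult_layer) auto
  also have "\<dots> \<le> (2 * exp 8) * (barrier i + 1 / (real N)\<^sup>2)"
  proof (rule mult_mono)
    have "exp (sqrt m * fine_step / eps) \<le> exp 8" using scaled_fine_step_le by simp
    then show "exp (sqrt m * fine_step / eps) \<le> 2 * exp 8" using exp_gt_zero[of 8] by linarith
    show "layer m eps (x i) \<le> barrier i + 1 / (real N)\<^sup>2"
      using i_fine
      by (intro layer_le_barrier) auto
  qed (auto simp: layer_pos less_imp_le)
  finally have "layer m eps t \<le> (2 * exp 8) * (1 / (real N)\<^sup>2 + barrier i)"
    by (simp add: add.commute)
  moreover have "C0\<^sup>2 / (real N)\<^sup>2 \<le> C0\<^sup>2 * (1 / (real N)\<^sup>2 + barrier i)"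
    using barrier_bounds(1)[of i] by (simp add: distrib_left)
  ultimately show ?thesis
    using eps_square_le unfolding envelope_def envelope_const_def distrib_right[of "C0\<^sup>2"]
    by linarith
qed

lemma truncation_error_fine_le:
  assumes i_fine: "0 < i" "i < N" "i < n \<or> 3 * n < i"
  shows "\<bar>truncation_error (h (i - 1)) (h i) (x i)\<bar>
    \<le> fine_const C0 * (1 / (real N)\<^sup>2 + layer_rate * barrier i)"
proof -
  let ?A = "envelope_const C0 * (1 / (real N)\<^sup>2 + barrier i)"
  let ?c = "1 + (4 + 2 * (4 / kappa m gam)\<^sup>2) / gam"
  have steps: "h (i - 1) = fine_step" "h i = fine_step" using i_fine by (auto intro!: h_outer)
  have "0 \<le> ?c" using gam_pos by (simp add: add_nonneg_nonneg)
  then have factor_nonneg: "0 \<le> 64 / m * ?c * (a_priori_const * envelope_const C0)"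
    using m_pos a_priori_const_bounds(1) envelope_const_nonneg by (intro mult_nonneg_nonneg) auto
  have "0 \<le> a_priori_const * ?A"
    using a_priori_const_bounds(1) envelope_const_nonneg barrier_bounds(1)[of i]
    by (intro mult_nonneg_nonneg add_nonneg_nonneg) auto
  have "\<bar>truncation_error fine_step fine_step (x i)\<bar>
      \<le> fine_step\<^sup>2 / eps\<^sup>2 * (1 + (4 + 2 * (beta * fine_step / 2)\<^sup>2) / gam) * (a_priori_const * ?A)"
  proof (rule abs_uniform_truncation_error_le[OF fine_step_pos])
    show "{x i - fine_step..x i + fine_step} \<subseteq> {0..1}"
      using stencil_subset[OF i_fine(1,2)] steps
      by simp
    show "envelope m eps t \<le> ?A" if "t \<in> {x i - fine_step..x i + fine_step}" for t
      using that by (intro envelope_le_barrier[OF i_fine]) auto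
  qed
  also have "\<dots> \<le> fine_step\<^sup>2 / eps\<^sup>2 * ?c * (a_priori_const * ?A)"
  proof (intro mult_right_mono mult_left_mono add_left_mono divide_right_mono)
    show "(beta * fine_step / 2)\<^sup>2 \<le> (4 / kappa m gam)\<^sup>2"
      using sigma_le sigma_pos unfolding sigma_def by (intro power_mono) auto
  qed (use \<open>0 \<le> a_priori_const * ?A\<close> gam_pos in auto)
  also have "\<dots> = 64 / m * ?c * (a_priori_const * envelope_const C0)
      * (layer_rate * (1 / (real N)\<^sup>2) + layer_rate * barrier i)"
    unfolding scaled_fine_step_square distrib_left[of layer_rate, symmetric]
    by (simp only: mult_ac)
  also have "\<dots> \<le> 64 / m * ?c * (a_priori_const * envelope_const C0)
      * (1 / (real N)\<^sup>2 + layer_rate * barrier i)"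
  proof (intro mult_left_mono add_right_mono)
    have "layer_rate * (1 / (real N)\<^sup>2) \<le> 1 * (1 / (real N)\<^sup>2)"
      using layer_rate_bounds(2) by (rule mult_right_mono) simp
    then show "layer_rate * (1 / (real N)\<^sup>2) \<le> 1 / (real N)\<^sup>2" by simp
  qed (rule factor_nonneg)
  finally show ?thesis unfolding steps fine_const_def .
qed

lemma linearised_error_equation:
  obtains c where "\<And>j. j \<le> N \<Longrightarrow> m \<le> c j \<and> c j \<le> gam"
    "\<And>i. 0 < i \<Longrightarrow> i < N \<Longrightarrow> linearised_op beta gam h c (\<lambda>j. y (x j) - yb j) i
      = truncation_error (h (i - 1)) (h i) (x i)"
proof -
  have "\<forall>j\<in>{..N}. \<exists>c. m \<le> c \<and> c \<le> gam \<and> f (x j, y (x j)) - f (x j, yb j) = c * (y (x j) - yb j)"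
  proof
    fix j
    assume "j \<in> {..N}"
    then have "x j \<in> {0..1}" using x_in_unit_interval by simp
    then show "\<exists>c. m \<le> c \<and> c \<le> gam \<and> f (x j, y (x j)) - f (x j, yb j) = c * (y (x j) - yb j)"
      using fibre_mean_value[of "x j" "yb j" "y (x j)"] fy_bounds by (metis SigmaI UNIV_I)
  qed
  then obtain c where c_bounds: "\<And>j. j \<le> N \<Longrightarrow> m \<le> c j \<and> c j \<le> gam"
    and quotient: "\<And>j. j \<le> N \<Longrightarrow> f (x j, y (x j)) - f (x j, yb j) = c j * (y (x j) - yb j)"
    by (metis atMost_iff)
  have "linearised_op beta gam h c (\<lambda>j. y (x j) - yb j) i = truncation_error (h (i - 1)) (h i) (x i)"
    if i_inner: "0 < i" "i < N" for i
  proof -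
    have "stencil_sum (\<lambda>j. c j * (y (x j) - yb j)) i
        = stencil_sum (\<lambda>j. f (x j, y (x j)) - f (x j, yb j)) i"
      using quotient i_inner by (simp add: stencil_sum_def)
    then have "linearised_op beta gam h c (\<lambda>j. y (x j) - yb j) i
        = mesh_op beta h (\<lambda>j. y (x j)) i - stencil_sum (\<lambda>j. f (x j, y (x j))) i / gam"
      unfolding linearised_op_def mesh_op_diff stencil_sum_diff scheme[OF i_inner]
      by (simp add: diff_divide_distrib)
    then show ?thesis
      unfolding truncation_error_def mesh_op_def stencil_sum_def x_pred[OF i_inner(1)] x_succ .
  qed
  with c_bounds show thesis by (rule that)
qed

definition error_barrier :: "nat \<Rightarrow> real" where
  "error_barrier i = base_weight C0 / (real N)\<^sup>2
     + layer_weight C0 * layer_rate * barrier i"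

lemma error_barrier_nonneg: "0 \<le> error_barrier i"
  using base_weight_nonneg layer_weight_nonneg layer_rate_bounds(1) barrier_bounds(1)[of i]
  by (simp add: error_barrier_def)

lemma barrier_op_error_barrier_eq:
  "barrier_op error_barrier i = layer_weight C0 * layer_rate * barrier_op barrier i
     - truncation_const C0 / (real N)\<^sup>2 - layer_weight C0 * kink_const m gam / (real N)\<^sup>2"
proof -
  have "4 * (m / gam) * base_weight C0 = truncation_const C0 + layer_weight C0 * kink_const m gam"
    using m_pos gam_pos by (simp add: base_weight_def)
  then have "4 * (m / gam) * (base_weight C0 / (real N)\<^sup>2)
      = truncation_const C0 / (real N)\<^sup>2 + layer_weight C0 * kink_const m gam / (real N)\<^sup>2"
    by (simp only: times_divide_eq_right add_divide_distrib)
  then show ?thesis unfolding error_barrier_def[abs_def] barrier_op_const_plus by simp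
qed

lemma weighted_barrier_op_fine_le:
  assumes "0 < i" "i < N" "i < n \<or> 3 * n < i"
  shows "layer_weight C0 * layer_rate * barrier_op barrier i
    \<le> - (truncation_const C0 * (layer_rate * barrier i))"
proof -
  have "layer_weight C0 * layer_rate * barrier_op barrier i
      \<le> layer_weight C0 * layer_rate * (- (7 / 4 * (m / gam)) * barrier i)"
    using layer_weight_nonneg layer_rate_bounds(1)
    by (intro mult_left_mono barrier_op_fine assms) auto
  also have "\<dots> = - (layer_weight C0 * (7 / 4 * (m / gam)) * (layer_rate * barrier i))"
    by (simp only: mult_ac mult_minus_left mult_minus_right)
  also have "layer_weight C0 * (7 / 4 * (m / gam)) = truncation_const C0"
    using m_pos gam_pos by (simp add: layer_weight_def)
  finally show ?thesis .
qed

lemma weighted_barrier_op_transition_le: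
  assumes "i = n \<or> i = 3 * n"
  shows "layer_weight C0 * layer_rate * barrier_op barrier i
    \<le> layer_weight C0 * kink_const m gam / (real N)\<^sup>2"
proof -
  have "layer_weight C0 * layer_rate * barrier_op barrier i
      \<le> layer_weight C0 * layer_rate * ((16 / sigma + 8 * sigma) * mu ^ n)"
    using layer_weight_nonneg layer_rate_bounds(1)
    by (intro mult_left_mono barrier_op_transition_le assms) auto
  also have "\<dots> = layer_weight C0 / (real N)\<^sup>2
      * ((ln (real N))\<^sup>2 * ((16 / sigma + 8 * sigma) * mu ^ n))"
    by (simp add: layer_rate_def)
  also have "\<dots> \<le> layer_weight C0 / (real N)\<^sup>2 * kink_const m gam"
    using layer_weight_nonneg by (intro mult_left_mono ln_square_mult_kink_le) auto
  finally show ?thesis by simp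
qed

lemma barrier_op_error_barrier_le:
  assumes i_inner: "0 < i" "i < N"
  shows "barrier_op error_barrier i \<le> - \<bar>truncation_error (h (i - 1)) (h i) (x i)\<bar>"
proof -
  have kink_nonneg: "0 \<le> layer_weight C0 * kink_const m gam / (real N)\<^sup>2"
    using layer_weight_nonneg kink_const_nonneg by simp
  have truncation_middle: "\<bar>truncation_error (h (i - 1)) (h i) (x i)\<bar>
      \<le> truncation_const C0 / (real N)\<^sup>2"
    if "n \<le> i" "i \<le> 3 * n"
    using truncation_error_middle_le[OF that]
      divide_right_mono[OF truncation_const_bounds(2), of "(real N)\<^sup>2" C0] by simp
  consider (fine) "i < n \<or> 3 * n < i" | (transition) "i = n \<or> i = 3 * n"
    | (middle) "n < i" "i < 3 * n" by linarith
  then show ?thesis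
  proof cases
    case fine
    have "fine_const C0 * (1 / (real N)\<^sup>2 + layer_rate * barrier i)
        \<le> truncation_const C0 * (1 / (real N)\<^sup>2 + layer_rate * barrier i)"
      using truncation_const_bounds(3) layer_rate_bounds(1) barrier_bounds(1)[of i]
      by (intro mult_right_mono add_nonneg_nonneg) auto
    then have "\<bar>truncation_error (h (i - 1)) (h i) (x i)\<bar>
        \<le> truncation_const C0 / (real N)\<^sup>2 + truncation_const C0 * (layer_rate * barrier i)"
      using truncation_error_fine_le[OF i_inner fine] by (simp add: distrib_left)
    then show ?thesis
      using weighted_barrier_op_fine_le[OF i_inner fine] kink_nonneg
      unfolding barrier_op_error_barrier_eq by linarith
  next
    case transition
    show ?thesis
      using truncation_middle weighted_barrier_op_transition_le[OF transition] transition n_pos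
      unfolding barrier_op_error_barrier_eq by auto
  next
    case middle
    have "layer_weight C0 * layer_rate * barrier_op barrier i \<le> 0"
      using layer_weight_nonneg layer_rate_bounds(1)
      by (intro mult_nonneg_nonpos barrier_op_middle_nonpos middle) auto
    then show ?thesis
      using truncation_middle middle kink_nonneg unfolding barrier_op_error_barrier_eq by auto
  qed
qed

lemma abs_error_le_error_barrier:
  assumes "i \<le> N"
  shows "\<bar>y (x i) - yb i\<bar> \<le> error_barrier i"
proof -
  obtain c where c_bounds: "\<And>j. j \<le> N \<Longrightarrow> m \<le> c j \<and> c j \<le> gam"
    and error_equation: "\<And>i. 0 < i \<Longrightarrow> i < N \<Longrightarrow>
      linearised_op beta gam h c (\<lambda>j. y (x j) - yb j) i = truncation_error (h (i - 1)) (h i) (x i)"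
    using linearised_error_equation by blast
  show ?thesis
  proof (rule discrete_comparison_principle[OF beta_pos m_pos h_pos c_bounds error_barrier_nonneg
      _ _ _ assms])
    show "y (x 0) - yb 0 = 0" "y (x N) - yb N = 0"
      using y_boundary yb_boundary by (simp_all add: x_0 x_N)
  qed (use barrier_op_error_barrier_le error_equation in auto)
qed

lemma error_le:
  assumes "i \<le> N"
  shows "\<bar>y (x i) - yb i\<bar> \<le> error_const C0 * (ln (real N))\<^sup>2 / (real N)\<^sup>2"
proof -
  let ?l = "(ln (real N))\<^sup>2"
  have "1 \<le> ?l" using ln_N_gt_1 by (simp add: one_le_power)
  then have "base_weight C0 * 1 \<le> base_weight C0 * ?l"
    using base_weight_nonneg
    by (intro mult_left_mono) auto
  moreover have "layer_weight C0 * (?l * barrier i)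
      \<le> layer_weight C0 * (?l * (1 + decay_const m gam))"
    using layer_weight_nonneg decay_const_nonneg barrier_bounds(2)[of i]
    by (intro mult_left_mono) auto
  ultimately have "base_weight C0 + layer_weight C0 * (?l * barrier i) \<le> error_const C0 * ?l"
    using \<open>1 \<le> ?l\<close> by (simp add: error_const_def algebra_simps)
  then have "(base_weight C0 + layer_weight C0 * (?l * barrier i)) / (real N)\<^sup>2
      \<le> error_const C0 * ?l / (real N)\<^sup>2" by (intro divide_right_mono) auto
  then show ?thesis
    using abs_error_le_error_barrier[OF assms]
    by (simp add: error_barrier_def layer_rate_def add_divide_distrib)
qed

lemma error_middle_le:
  assumes "n \<le> i" "i \<le> 3 * n"
  shows "\<bar>y (x i) - yb i\<bar> \<le> error_const C0 / (real N)\<^sup>2"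
proof -
  have "layer_weight C0 * ((ln (real N))\<^sup>2 * barrier i) \<le> layer_weight C0 * decay_const m gam"
    by (intro mult_left_mono ln_square_mult_barrier_middle_le assms layer_weight_nonneg)
  then have "base_weight C0 + layer_weight C0 * ((ln (real N))\<^sup>2 * barrier i) \<le> error_const C0"
    using layer_weight_nonneg[of C0] unfolding error_const_def distrib_left by linarith
  then have "(base_weight C0 + layer_weight C0 * ((ln (real N))\<^sup>2 * barrier i)) / (real N)\<^sup>2
      \<le> error_const C0 / (real N)\<^sup>2" by (intro divide_right_mono) auto
  moreover have "i \<le> N" using assms N_eq by simp
  ultimately show ?thesis
    using abs_error_le_error_barrier[of i]
    by (simp add: error_barrier_def layer_rate_def add_divide_distrib)
qed

end

lemma reaction_term_of_Ck_on:
  fixes f :: "real \<Rightarrow> real \<Rightarrow> real"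
  assumes "2 \<le> k" "Ck_on k strip (\<lambda>(x, v). f x v)" "0 < m"
    and "\<And>x v. x \<in> {0..1} \<Longrightarrow> m \<le> deriv (f x) v" "\<And>x v. x \<in> {0..1} \<Longrightarrow> deriv (f x) v \<le> gam"
  obtains fx fy fxx fxy fyx fyy where
    "reaction_term (\<lambda>(x, v). f x v) fx fy fxx fxy fyx fyy m gam"
proof -
  have "Ck_on (Suc (Suc 0)) strip (\<lambda>(x, v). f x v)"
    using Ck_on_le[OF _ assms(2), of 2] assms(1) by (simp only: numeral_2_eq_2)
  then obtain fx fy fxx fxy fyx fyy where
    partials: "has_partial_derivatives (\<lambda>(x, v). f x v) fx fy strip"
      "has_partial_derivatives fx fxx fxy strip" "has_partial_derivatives fy fyx fyy strip"
    and continuous: "continuous_on strip fxx" "continuous_on strip fxy"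
      "continuous_on strip fyx" "continuous_on strip fyy"
    unfolding Ck_on_Suc_iff Ck_on.simps(1) by blast
  have "deriv (f x) v = fy (x, v)" if "x \<in> {0..1}" for x v
    using derivative_along_fibre[OF partials(1) that, of v] by (simp add: DERIV_imp_deriv)
  then have "reaction_term (\<lambda>(x, v). f x v) fx fy fxx fxy fyx fyy m gam"
    using partials continuous assms(3-5) by unfold_locales force+
  then show thesis by (rule that)
qed

theorem theorem3:
  fixes f :: "real \<Rightarrow> real \<Rightarrow> real" and k :: nat and m gam C0 :: real
  assumes k2: "k \<ge> 2"
    and fCk: "Ck_on k ({0..1} \<times> UNIV) (\<lambda>(x, v). f x v)"
    and mpos: "m > 0"
    and fy_lower: "\<forall>x\<in>{0..1}. \<forall>v. m \<le> deriv (f x) v"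
    and fy_upper: "\<forall>x\<in>{0..1}. \<forall>v. deriv (f x) v \<le> gam"
  shows "\<exists>C>0. \<forall>(eps::real) (N::nat) (y::real \<Rightarrow> real) (yb::nat \<Rightarrow> real).
     0 < eps \<longrightarrow> eps < 1 \<longrightarrow>
     (\<exists>y' y''. \<forall>x\<in>{0..1}. (y has_real_derivative y' x) (at x within {0..1}) \<and>
                          (y' has_real_derivative y'' x) (at x within {0..1}) \<and>
                          eps^2 * y'' x = f x (y x)) \<longrightarrow>
     y 0 = 0 \<longrightarrow> y 1 = 0 \<longrightarrow>
     0 < N \<longrightarrow> 4 dvd N \<longrightarrow>
     lam_mesh m eps N \<le> q_mesh \<longrightarrow> eps \<le> C0 / real N \<longrightarrow>
     yb 0 = 0 \<longrightarrow> yb N = 0 \<longrightarrow>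
     (\<forall>i\<in>{1..N-1}.
        gam / (Ddm gam m eps N i + Ddm gam m eps N (i+1)) *
          ((3 * am gam m eps N i + dm gam m eps N i + Ddm gam m eps N (i+1)) * (yb (i-1) - yb i)
           - (3 * am gam m eps N (i+1) + dm gam m eps N (i+1) + Ddm gam m eps N i) * (yb i - yb (i+1))
           - (f (xm m eps N (i-1)) (yb (i-1)) + 2 * f (xm m eps N i) (yb i)
               + f (xm m eps N (i+1)) (yb (i+1))) / gam
             * (Ddm gam m eps N i + Ddm gam m eps N (i+1))) = 0) \<longrightarrow>
     (\<forall>i. i < N div 4 \<longrightarrow>
          \<bar>y (xm m eps N i) - yb i\<bar> \<le> C * (ln (real N))^2 / (real N)^2) \<and>
     (\<forall>i. N div 4 \<le> i \<and> i \<le> 3 * N div 4 \<longrightarrow>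
          \<bar>y (xm m eps N i) - yb i\<bar> \<le> C / (real N)^2) \<and>
     (\<forall>i. 3 * N div 4 < i \<and> i \<le> N \<longrightarrow>
          \<bar>y (xm m eps N i) - yb i\<bar> \<le> C * (ln (real N))^2 / (real N)^2)"
proof -
  obtain fx fy fxx fxy fyx fyy where
    "reaction_term (\<lambda>(x, v). f x v) fx fy fxx fxy fyx fyy m gam"
    using reaction_term_of_Ck_on[OF k2 fCk mpos] fy_lower fy_upper by blast
  then interpret reaction_term "\<lambda>(x, v). f x v" fx fy fxx fxy fyx fyy m gam .
  show ?thesis
  proof (intro exI[of _ "error_const C0"] conjI[OF error_const_pos] allI impI, goal_cases)
    case hyps: (1 eps N y yb)
    then obtain y' where "has_two_derivatives y y' (\<lambda>x. f x (y x) / eps\<^sup>2) {0..1}"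
      unfolding has_two_derivatives_def
      by (metis less_irrefl nonzero_mult_div_cancel_left power_eq_0_iff)
    with hyps interpret
      singularly_perturbed_bvp "\<lambda>(x, v). f x v" fx fy fxx fxy fyx fyy m gam eps y y'
      by unfold_locales auto
    interpret shishkin_barrier m eps N gam
      using hyps mpos m_le_gam by unfold_locales
    have "mesh_op (sqrt gam / eps) (hm m eps N) yb i
        = stencil_sum (\<lambda>j. f (xm m eps N j) (yb j)) i / gam"
      if "0 < i" "i < N" for i
      unfolding stencil_sum_def
      by (rule scheme_imp_mesh_op[OF that], rule hyps(12)[rule_format]) (use that in simp)
    with hyps interpret
      discretised_bvp "\<lambda>(x, v). f x v" fx fy fxx fxy fyx fyy m gam eps y y' N yb C0
      by unfold_locales auto
    have "N div 4 = n" "3 * N div 4 = 3 * n" using N_eq by auto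
    then show ?case using error_le error_middle_le N_eq by auto
  qed
qed

end
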